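(* Let $B$ be a unital algebra and $n\in\mathbb{N}$. Then the map \[\Phi:\mathrm{Hom}_{\mathrm{gr}}(C_n,\mathrm{Aut}(B))/\!\sim\;\rightarrow\;\mathrm{Ext}(C_n,B)_{\mathrm{split}},\quad [S]\mapsto[A_S],\] is a well-defined bijection.
   Context: All algebras are associative and complex. $C_n=\{\zeta^k:k=0,\ldots,n-1\}\subseteq\mathbb{C}^\times$ with $\zeta=\exp(2\pi i/n)$. $\mathrm{Hom}_{\mathrm{gr}}$ denotes the set of group homomorphisms, $\mathrm{Aut}(B)$ the group of algebra automorphisms of $B$, $B^{\times}$ the unit group, $Z(B)$ the center, and $C_B:B^{\times}\rightarrow\mathrm{Aut}(B)$, $C_B(u)(b)=ubu^{-1}$, the conjugation action. $C^1(C_n,B^\times)$ is the set of maps $h:C_n\to B^\times$ with $h(1)=1_B$. Equivalence of homomorphisms: $S,S'\in\mathrm{Hom}_{\mathrm{gr}}(C_n,\mathrm{Aut}(B))$ are equivalent, $S\sim S'$, if there exists $h\in C^1(C_n,B^{\times})$ such that (i) $S'=(C_B\circ h)\cdot S$ (pointwise product), and (ii) the class $[d_Sh]\in H^2(C_n,Z(B)^{\times})_S$ vanishes, where $d_Sh(\zeta^k,\zeta^l):=h(\zeta^k)\,S(\zeta^k)(h(\zeta^l))\,h(\zeta^{k+l})^{-1}$. (Condition (i) ensures that $d_Sh$ takes values in $Z(B)^\times$ and is a 2-cocycle; $H^2(C_n,Z(B)^{\times})_S$ is ordinary group cohomology with the $C_n$-module structure on $Z(B)^\times$ given by $S$.)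 This is an equivalence relation. Crossed product algebras: for a group $G$, a $(G,B)$-crossed product algebra is a $G$-graded unital algebra $A=\bigoplus_{g\in G}A_g$ with $A_{1_G}=B$ such that each $A_g$ contains an invertible element. Two such algebras $A,A'$ are equivalent if there is an algebra isomorphism $\varphi:A\to A'$ with $\varphi(A_g)=A'_g$ for all $g$ and $\varphi|_B=\mathrm{id}_B$; $[A]$ is the equivalence class. With $A_g^\times:=A_g\cap A^\times$ and $A_h^\times:=\bigcup_{g}A_g^{\times}$ (a subgroup of $A^\times$), there is an associated short exact sequence $1\to B^\times\to A_h^\times\xrightarrow{q}G\to 1$, where $q$ maps elements of $A_g^\times$ to $g$. It is split if there is a group homomorphism $\sigma:G\to A_h^\times$ with $\sigma(g)\in A_g$ for all $g$ (i.e. $q\circ\sigma=\mathrm{id}_G$). $\mathrm{Ext}(C_n,B)_{\mathrm{split}}$ is the set of equivalence classes of $(C_n,B)$-crossed product algebras whose associated sequence is split. For $S\in\mathrm{Hom}_{\mathrm{gr}}(C_n,\mathrm{Aut}(B))$, $A_S$ is the $(C_n,B)$-crossed product algebra $\bigoplus_{g\in C_n}Bv_g$ (free left $B$-module with basis $(v_g)_{g\in C_n}$, with $B$ identified with $Bv_1$) with multiplication $(bv_g)(b'v_{g'})=b\,S(g)(b')\,v_{gg'}$. *)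

theory Defs
  imports Complex_Main "HOL-Algebra.Algebra" "HOL-Algebra.Algebraic_Closure_Type"
begin

section \<open>Complex unital associative algebras\<close>

abbreviation complex_ring :: "complex ring"
  where "complex_ring \<equiv> ring_of_type_algebra"

text \<open>The library locale \<^locale>\<open>algebra\<close> requires a commutative multiplication, so it cannot be used
  here.\<close>

locale complex_algebra =
  module complex_ring B + ring B
  for B :: "(complex, 'b, 'm) module_scheme" (structure) +
  assumes smult_mult_left:
      "\<lbrakk>x \<in> carrier B; y \<in> carrier B\<rbrakk> \<Longrightarrow> (c \<odot>\<^bsub>B\<^esub> x) \<otimes>\<^bsub>B\<^esub> y = c \<odot>\<^bsub>B\<^esub> (x \<otimes>\<^bsub>B\<^esub> y)"
    and smult_mult_right:
      "\<lbrakk>x \<in> carrier B; y \<in> carrier B\<rbrakk> \<Longrightarrow> x \<otimes>\<^bsub>B\<^esub> (c \<odot>\<^bsub>B\<^esub> y) = c \<odot>\<^bsub>B\<^esub> (x \<otimes>\<^bsub>B\<^esub> y)"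

definition alg_hom ::
  "(complex, 'a, 'm) module_scheme \<Rightarrow> (complex, 'b, 'k) module_scheme \<Rightarrow> ('a \<Rightarrow> 'b) set"
  where "alg_hom A B =
    {f \<in> ring_hom A B. \<forall>c. \<forall>x\<in>carrier A. f (c \<odot>\<^bsub>A\<^esub> x) = c \<odot>\<^bsub>B\<^esub> f x}"

definition alg_iso ::
  "(complex, 'a, 'm) module_scheme \<Rightarrow> (complex, 'b, 'k) module_scheme \<Rightarrow> ('a \<Rightarrow> 'b) set"
  where "alg_iso A B = {f \<in> alg_hom A B. bij_betw f (carrier A) (carrier B)}"

definition alg_Aut :: "(complex, 'b, 'm) module_scheme \<Rightarrow> ('b \<Rightarrow> 'b) monoid"
  where "alg_Aut B = BijGroup (carrier B) \<lparr>carrier := alg_iso B B \<inter> Bij (carrier B)\<rparr>"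

definition center :: "('b, 'm) monoid_scheme \<Rightarrow> 'b set"
  where "center B = {z \<in> carrier B. \<forall>b\<in>carrier B. z \<otimes>\<^bsub>B\<^esub> b = b \<otimes>\<^bsub>B\<^esub> z}"

definition center_units :: "('b, 'm) monoid_scheme \<Rightarrow> 'b monoid"
  where "center_units B = units_of (B\<lparr>carrier := center B\<rparr>)"

definition conj_action :: "('b, 'm) monoid_scheme \<Rightarrow> 'b \<Rightarrow> 'b \<Rightarrow> 'b"
  where "conj_action B u = (\<lambda>b\<in>carrier B. u \<otimes>\<^bsub>B\<^esub> b \<otimes>\<^bsub>B\<^esub> inv\<^bsub>B\<^esub> u)"


section \<open>Group homomorphisms and second group cohomology\<close>

definition roots_of_unity_group :: "nat \<Rightarrow> complex monoid"
  where "roots_of_unity_group n =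
    \<lparr>carrier = {exp (2 * of_real pi * \<i> / of_nat n) ^ k | k. k < n}, monoid.mult = (*), one = 1\<rparr>"

text \<open>Homomorphisms are extensional, so that equality in \<open>hom_gr G H\<close> is equality of maps on the
  carrier of \<open>G\<close>.\<close>

definition hom_gr :: "('g, 'm) monoid_scheme \<Rightarrow> ('h, 'k) monoid_scheme \<Rightarrow> ('g \<Rightarrow> 'h) set"
  where "hom_gr G H = hom G H \<inter> extensional (carrier G)"

text \<open>The map \<open>d_a\<close> is defined for maps into an arbitrary group \<open>M\<close>. It is used both for the
  1-cochains with values in the abelian group \<open>Z(B)\<^sup>\<times>\<close>, where its range is the group of
  2-coboundaries, and for the maps into the nonabelian group \<open>B\<^sup>\<times>\<close>.\<close>

definition coboundary ::
  "('g, 'm) monoid_scheme \<Rightarrow> ('c, 'k) monoid_scheme \<Rightarrow> ('g \<Rightarrow> 'c \<Rightarrow> 'c) \<Rightarrow> ('g \<Rightarrow> 'c) \<Rightarrow> 'g \<times> 'g \<Rightarrow> 'c"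
  where "coboundary G M a h =
    (\<lambda>(x, y)\<in>carrier G \<times> carrier G. h x \<otimes>\<^bsub>M\<^esub> a x (h y) \<otimes>\<^bsub>M\<^esub> inv\<^bsub>M\<^esub> (h (x \<otimes>\<^bsub>G\<^esub> y)))"

definition cocycles2 ::
  "('g, 'm) monoid_scheme \<Rightarrow> ('c, 'k) monoid_scheme \<Rightarrow> ('g \<Rightarrow> 'c \<Rightarrow> 'c) \<Rightarrow> ('g \<times> 'g \<Rightarrow> 'c) monoid"
  where "cocycles2 G M a =
    (product_group (carrier G \<times> carrier G) (\<lambda>_. M))
      \<lparr>carrier := {c \<in> carrier G \<times> carrier G \<rightarrow>\<^sub>E carrier M.
         \<forall>x\<in>carrier G. \<forall>y\<in>carrier G. \<forall>z\<in>carrier G.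
           a x (c (y, z)) \<otimes>\<^bsub>M\<^esub> c (x, y \<otimes>\<^bsub>G\<^esub> z) = c (x \<otimes>\<^bsub>G\<^esub> y, z) \<otimes>\<^bsub>M\<^esub> c (x, y)}\<rparr>"

definition coboundaries2 ::
  "('g, 'm) monoid_scheme \<Rightarrow> ('c, 'k) monoid_scheme \<Rightarrow> ('g \<Rightarrow> 'c \<Rightarrow> 'c) \<Rightarrow> ('g \<times> 'g \<Rightarrow> 'c) set"
  where "coboundaries2 G M a = coboundary G M a ` (carrier G \<rightarrow>\<^sub>E carrier M)"

definition H2 ::
  "('g, 'm) monoid_scheme \<Rightarrow> ('c, 'k) monoid_scheme \<Rightarrow> ('g \<Rightarrow> 'c \<Rightarrow> 'c) \<Rightarrow> ('g \<times> 'g \<Rightarrow> 'c) set monoid"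
  where "H2 G M a = cocycles2 G M a Mod coboundaries2 G M a"

definition H2_class ::
  "('g, 'm) monoid_scheme \<Rightarrow> ('c, 'k) monoid_scheme \<Rightarrow> ('g \<Rightarrow> 'c \<Rightarrow> 'c) \<Rightarrow>
    ('g \<times> 'g \<Rightarrow> 'c) \<Rightarrow> ('g \<times> 'g \<Rightarrow> 'c) set"
  where "H2_class G M a c = coboundaries2 G M a #>\<^bsub>cocycles2 G M a\<^esub> c"


section \<open>Equivalence of homomorphisms\<close>

definition C1 :: "('g, 'm) monoid_scheme \<Rightarrow> ('b, 'k) monoid_scheme \<Rightarrow> ('g \<Rightarrow> 'b) set"
  where "C1 G B = {h \<in> carrier G \<rightarrow>\<^sub>E Units B. h \<one>\<^bsub>G\<^esub> = \<one>\<^bsub>B\<^esub>}"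

definition hom_equiv ::
  "('g, 'm) monoid_scheme \<Rightarrow> (complex, 'b, 'k) module_scheme \<Rightarrow>
    (('g \<Rightarrow> 'b \<Rightarrow> 'b) \<times> ('g \<Rightarrow> 'b \<Rightarrow> 'b)) set"
  where "hom_equiv G B =
    {(S, S'). S \<in> hom_gr G (alg_Aut B) \<and> S' \<in> hom_gr G (alg_Aut B) \<and>
      (\<exists>h\<in>C1 G B.
        (\<forall>g\<in>carrier G. S' g = conj_action B (h g) \<otimes>\<^bsub>alg_Aut B\<^esub> S g) \<and>
        H2_class G (center_units B) S (coboundary G (units_of B) S h)
          = \<one>\<^bsub>H2 G (center_units B) S\<^esub>)}"


section \<open>Crossed product algebras\<close>

text \<open>The identification \<open>A\<^sub>1 = B\<close> is part of the data of a crossed product algebra: \<open>embed\<close> is the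
  inclusion of \<open>B\<close> as the component of degree 1.\<close>

record ('g, 'b, 'a) graded_algebra = "(complex, 'a) module" +
  component :: "'g \<Rightarrow> 'a set"
  embed :: "'b \<Rightarrow> 'a"

locale crossed_product =
  G: group G + B: complex_algebra B + A: complex_algebra A
  for G :: "('g, 'm) monoid_scheme"
    and B :: "(complex, 'b, 'k) module_scheme"
    and A :: "('g, 'b, 'a) graded_algebra" +
  assumes component_submodule:
      "g \<in> carrier G \<Longrightarrow> submodule (component A g) complex_ring A"
    and direct_sum:
      "x \<in> carrier A \<Longrightarrow> \<exists>!f. f \<in> (\<Pi>\<^sub>E g\<in>carrier G. component A g) \<and>
         finite {g \<in> carrier G. f g \<noteq> \<zero>\<^bsub>A\<^esub>} \<and>
         x = finsum A f {g \<in> carrier G. f g \<noteq> \<zero>\<^bsub>A\<^esub>}"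
    and component_mult:
      "\<lbrakk>g \<in> carrier G; g' \<in> carrier G; x \<in> component A g; y \<in> component A g'\<rbrakk>
         \<Longrightarrow> x \<otimes>\<^bsub>A\<^esub> y \<in> component A (g \<otimes>\<^bsub>G\<^esub> g')"
    and embed_hom: "embed A \<in> alg_hom B A"
    and embed_bij: "bij_betw (embed A) (carrier B) (component A \<one>\<^bsub>G\<^esub>)"
    and invertible_in_component:
      "g \<in> carrier G \<Longrightarrow> component A g \<inter> Units A \<noteq> {}"

definition homogeneous_units ::
  "('g, 'm) monoid_scheme \<Rightarrow> ('g, 'b, 'a) graded_algebra \<Rightarrow> 'a monoid"
  where "homogeneous_units G A =
    (units_of A)\<lparr>carrier := (\<Union>g\<in>carrier G. component A g \<inter> Units A)\<rparr>"

definition split_sequence ::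
  "('g, 'm) monoid_scheme \<Rightarrow> ('g, 'b, 'a) graded_algebra \<Rightarrow> bool"
  where "split_sequence G A \<longleftrightarrow>
    (\<exists>\<sigma>\<in>hom G (homogeneous_units G A). \<forall>g\<in>carrier G. \<sigma> g \<in> component A g)"

definition equivalent ::
  "('g, 'm) monoid_scheme \<Rightarrow> (complex, 'b, 'k) module_scheme \<Rightarrow>
    ('g, 'b, 'a) graded_algebra \<Rightarrow> ('g, 'b, 'c) graded_algebra \<Rightarrow> bool"
  where "equivalent G B A A' \<longleftrightarrow>
    (\<exists>\<phi>\<in>alg_iso A A'. (\<forall>g\<in>carrier G. \<phi> ` component A g = component A' g) \<and>
      (\<forall>b\<in>carrier B. \<phi> (embed A b) = embed A' b))"

text \<open>Equivalence classes are formed among the algebras whose elements are of a given type \<open>'a\<close>.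
  \<^const>\<open>equivalent\<close> also compares algebras over different types.\<close>

definition ext_rel ::
  "('g, 'm) monoid_scheme \<Rightarrow> (complex, 'b, 'k) module_scheme \<Rightarrow>
    (('g, 'b, 'a) graded_algebra \<times> ('g, 'b, 'a) graded_algebra) set"
  where "ext_rel G B =
    {(A, A'). crossed_product G B A \<and> crossed_product G B A' \<and> equivalent G B A A'}"

definition Ext_split ::
  "('g, 'm) monoid_scheme \<Rightarrow> (complex, 'b, 'k) module_scheme \<Rightarrow>
    ('g, 'b, 'a) graded_algebra set set"
  where "Ext_split G B =
    {A. crossed_product G B A \<and> split_sequence G A} // ext_rel G B"


section \<open>The crossed product algebra of a homomorphism\<close>

text \<open>For a finite group \<open>G\<close>, the element \<open>\<Sum>\<^sub>g b\<^sub>g v\<^sub>g\<close> of the free left \<open>B\<close>-module on \<open>(v\<^sub>g)\<close> is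
  represented by the coefficient function \<open>g \<mapsto> b\<^sub>g\<close>, and \<open>monomial G B b g\<close> is \<open>b v\<^sub>g\<close>.
  The multiplication is the biadditive extension of
  \<open>(b v\<^sub>g) (b' v\<^sub>h) = b S(g)(b') v\<^bsub>gh\<^esub>\<close>.\<close>

definition monomial ::
  "('g, 'm) monoid_scheme \<Rightarrow> ('b, 'k) ring_scheme \<Rightarrow> 'b \<Rightarrow> 'g \<Rightarrow> 'g \<Rightarrow> 'b"
  where "monomial G B b g = (\<lambda>k\<in>carrier G. if k = g then b else \<zero>\<^bsub>B\<^esub>)"

definition twisted_algebra ::
  "('g, 'm) monoid_scheme \<Rightarrow> (complex, 'b, 'k) module_scheme \<Rightarrow> ('g \<Rightarrow> 'b \<Rightarrow> 'b) \<Rightarrow>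
    ('g, 'b, 'g \<Rightarrow> 'b) graded_algebra"
  where "twisted_algebra G B S =
    \<lparr>carrier = carrier G \<rightarrow>\<^sub>E carrier B,
     monoid.mult = (\<lambda>x y. \<lambda>k\<in>carrier G.
       finsum B (\<lambda>(g, h). x g \<otimes>\<^bsub>B\<^esub> S g (y h))
         {(g, h) \<in> carrier G \<times> carrier G. g \<otimes>\<^bsub>G\<^esub> h = k}),
     one = monomial G B \<one>\<^bsub>B\<^esub> \<one>\<^bsub>G\<^esub>,
     ring.zero = (\<lambda>k\<in>carrier G. \<zero>\<^bsub>B\<^esub>),
     ring.add = (\<lambda>x y. \<lambda>k\<in>carrier G. x k \<oplus>\<^bsub>B\<^esub> y k),
     module.smult = (\<lambda>c x. \<lambda>k\<in>carrier G. c \<odot>\<^bsub>B\<^esub> x k),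
     component = (\<lambda>g. (\<lambda>b. monomial G B b g) ` carrier B),
     embed = (\<lambda>b. monomial G B b \<one>\<^bsub>G\<^esub>)\<rparr>"

lemma twisted_algebra_mult_monomial:
  assumes B: "complex_algebra B" and G: "group G" "finite (carrier G)"
    and S: "S \<in> hom_gr G (alg_Aut B)"
    and g: "g \<in> carrier G" "h \<in> carrier G" and b: "b \<in> carrier B" "c \<in> carrier B"
  shows "monomial G B b g \<otimes>\<^bsub>twisted_algebra G B S\<^esub> monomial G B c h
    = monomial G B (b \<otimes>\<^bsub>B\<^esub> S g c) (g \<otimes>\<^bsub>G\<^esub> h)"
proof -
  interpret B: complex_algebra B by (rule B)
  interpret G: group G by (rule G(1))
  have Sh: "S x \<in> ring_hom B B" if "x \<in> carrier G" for x
    using S that by (auto simp: hom_gr_def alg_Aut_def hom_def alg_iso_def alg_hom_def)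
  have S0: "S x \<zero>\<^bsub>B\<^esub> = \<zero>\<^bsub>B\<^esub>" if "x \<in> carrier G" for x
    using ring_hom_zero[OF Sh[OF that] B.ring_axioms B.ring_axioms] .
  have Sc: "S x d \<in> carrier B" if "x \<in> carrier G" "d \<in> carrier B" for x d
    using ring_hom_closed[OF Sh[OF that(1)] that(2)] .
  define P where "P k = {(x, y) \<in> carrier G \<times> carrier G. x \<otimes>\<^bsub>G\<^esub> y = k}" for k
  have fin: "finite (P k)" for k
    by (rule finite_subset[of _ "carrier G \<times> carrier G"]) (auto simp: P_def G)
  have eq: "(case p of (x, y) \<Rightarrow> monomial G B b g x \<otimes>\<^bsub>B\<^esub> S x (monomial G B c h y))
      = (if (g, h) = p then b \<otimes>\<^bsub>B\<^esub> S g c else \<zero>\<^bsub>B\<^esub>)" if "p \<in> P k" for p k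
    using that b g by (auto simp: P_def monomial_def S0 Sc split: if_splits)
  have "finsum B (\<lambda>(x, y). monomial G B b g x \<otimes>\<^bsub>B\<^esub> S x (monomial G B c h y)) (P k)
      = (if k = g \<otimes>\<^bsub>G\<^esub> h then b \<otimes>\<^bsub>B\<^esub> S g c else \<zero>\<^bsub>B\<^esub>)" if "k \<in> carrier G" for k
  proof -
    have "finsum B (\<lambda>(x, y). monomial G B b g x \<otimes>\<^bsub>B\<^esub> S x (monomial G B c h y)) (P k)
       = finsum B (\<lambda>p. if (g, h) = p then b \<otimes>\<^bsub>B\<^esub> S g c else \<zero>\<^bsub>B\<^esub>) (P k)"
      by (rule B.finsum_cong') (use eq b g Sc in auto)
    also have "\<dots> = (if k = g \<otimes>\<^bsub>G\<^esub> h then b \<otimes>\<^bsub>B\<^esub> S g c else \<zero>\<^bsub>B\<^esub>)"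
    proof (cases "k = g \<otimes>\<^bsub>G\<^esub> h")
      case True
      then have "(g, h) \<in> P k" using g by (simp add: P_def)
      from B.finsum_singleton[OF this fin, of "\<lambda>_. b \<otimes>\<^bsub>B\<^esub> S g c"] True b g Sc
      show ?thesis by simp
    next
      case False
      then have "finsum B (\<lambda>p. if (g, h) = p then b \<otimes>\<^bsub>B\<^esub> S g c else \<zero>\<^bsub>B\<^esub>) (P k)
         = finsum B (\<lambda>p. \<zero>\<^bsub>B\<^esub>) (P k)"
        by (intro B.finsum_cong') (auto simp: P_def)
      with False show ?thesis by simp
    qed
    finally show ?thesis .
  qed
  then show ?thesis
    unfolding twisted_algebra_def P_def
    by (auto simp: monomial_def[of G B "b \<otimes>\<^bsub>B\<^esub> S g c"] intro!: restrict_ext)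
qed

definition ext_class ::
  "('g, 'm) monoid_scheme \<Rightarrow> (complex, 'b, 'k) module_scheme \<Rightarrow> ('g \<Rightarrow> 'b \<Rightarrow> 'b) \<Rightarrow>
    ('g, 'b, 'g \<Rightarrow> 'b) graded_algebra set"
  where "ext_class G B S = ext_rel G B `` {twisted_algebra G B S}"

text \<open>On a set of homomorphisms on which \<open>S \<mapsto> [A\<^sub>S]\<close> is constant, \<open>Phi\<close> is the common value.\<close>

definition Phi ::
  "('g, 'm) monoid_scheme \<Rightarrow> (complex, 'b, 'k) module_scheme \<Rightarrow> ('g \<Rightarrow> 'b \<Rightarrow> 'b) set \<Rightarrow>
    ('g, 'b, 'g \<Rightarrow> 'b) graded_algebra set"
  where "Phi G B c = the_elem (ext_class G B ` c)"

end

theory Submission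
  imports Defs
begin

text \<open>
  Everything works for an arbitrary finite group \<open>G\<close> in place of \<open>C\<^sub>n\<close>. If \<open>A\<close> is a crossed product
  with a multiplicative section \<open>\<sigma>\<close> satisfying \<open>\<sigma>(g) b = S(g)(b) \<sigma>(g)\<close>, then
  \<open>\<Sum> b\<^sub>g v\<^sub>g \<mapsto> \<Sum> b\<^sub>g \<sigma>(g)\<close> is an equivalence \<open>A\<^sub>S \<rightarrow> A\<close>. Applied to a splitting \<open>\<sigma>\<close> of \<open>A\<close> and to
  conjugation by \<open>\<sigma>(g)\<close> this yields surjectivity.

  Dividing \<open>h\<close> by a central cochain whose coboundary is \<open>d\<^sub>S h\<close> shows that \<open>S \<sim> S'\<close> holds iff
  there is \<open>h : G \<rightarrow> B\<^sup>\<times>\<close> with \<open>S'(g) = C\<^sub>B(h(g)) S(g)\<close> and \<open>h(xy) = h(x) S(x)(h(y))\<close>. Such maps \<open>h\<close>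
  are the same as covariant sections \<open>g \<mapsto> h(g) v\<^sub>g\<close> of \<open>A\<^sub>S\<close> for \<open>S'\<close>, i.e. the same as
  equivalences between \<open>A\<^sub>S\<^sub>'\<close> and \<open>A\<^sub>S\<close>. Hence \<open>S \<sim> S'\<close> iff \<open>A\<^sub>S\<close> and \<open>A\<^sub>S\<^sub>'\<close> are equivalent.
\<close>

section \<open>Finite sums and automorphism groups\<close>

text \<open>Reorders the double sums behind associativity of the twisted product and
  multiplicativity of \<open>assemble\<close>. Induction on \<open>I\<close>, with
  \<open>finsum_addf\<close> splitting off one row.\<close>

lemma (in abelian_monoid) finsum_swap:
  assumes "finite I" "finite J" and "\<And>i j. i \<in> I \<Longrightarrow> j \<in> J \<Longrightarrow> f i j \<in> carrier G"
  shows "(\<Oplus>i\<in>I. \<Oplus>j\<in>J. f i j) = (\<Oplus>j\<in>J. \<Oplus>i\<in>I. f i j)"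
  using assms(1,3)
proof (induction I rule: finite_induct)
  case empty
  then show ?case by simp
next
  case (insert a I)
  have c: "f a \<in> J \<rightarrow> carrier G" "(\<lambda>j. \<Oplus>i\<in>I. f i j) \<in> J \<rightarrow> carrier G"
    "(\<lambda>i. \<Oplus>j\<in>J. f i j) \<in> I \<rightarrow> carrier G"
    using insert.prems by (auto intro!: finsum_closed)
  have "(\<Oplus>j\<in>J. \<Oplus>i\<in>insert a I. f i j) = (\<Oplus>j\<in>J. f a j \<oplus> (\<Oplus>i\<in>I. f i j))"
    by (intro finsum_cong' refl) (use insert c in \<open>auto intro!: finsum_insert\<close>)
  also have "\<dots> = (\<Oplus>j\<in>J. f a j) \<oplus> (\<Oplus>j\<in>J. \<Oplus>i\<in>I. f i j)"
    using c by (intro finsum_addf) auto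
  finally show ?case
    using insert c by (subst finsum_insert) (auto intro!: finsum_closed)
qed

text \<open>Applied to three additive maps: an automorphism \<open>S g\<close>, evaluation of
  coefficient functions at a point, and the inclusion \<open>embed A\<close>.\<close>

lemma (in abelian_monoid) finsum_additive:
  assumes H: "abelian_monoid H"
    and h: "\<And>x. x \<in> carrier G \<Longrightarrow> h x \<in> carrier H" "h \<zero> = \<zero>\<^bsub>H\<^esub>"
      "\<And>x y. x \<in> carrier G \<Longrightarrow> y \<in> carrier G \<Longrightarrow> h (x \<oplus> y) = h x \<oplus>\<^bsub>H\<^esub> h y"
    and I: "finite I" and f: "\<And>i. i \<in> I \<Longrightarrow> f i \<in> carrier G"
  shows "h (finsum G f I) = finsum H (\<lambda>i. h (f i)) I"
  using I f
proof (induction I rule: finite_induct)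
  case empty
  interpret H: abelian_monoid H by (rule H)
  show ?case by (simp add: h)
next
  case (insert a I)
  interpret H: abelian_monoid H by (rule H)
  have f: "f \<in> I \<rightarrow> carrier G" using insert by auto
  have "h (finsum G f (insert a I)) = h (f a \<oplus> finsum G f I)"
    using insert f by (subst finsum_insert) auto
  also have "\<dots> = h (f a) \<oplus>\<^bsub>H\<^esub> finsum H (\<lambda>i. h (f i)) I"
    using insert f by (subst h) (auto intro!: finsum_closed)
  also have "\<dots> = finsum H (\<lambda>i. h (f i)) (insert a I)"
    using insert h f by (subst H.finsum_insert) auto
  finally show ?case .
qed

lemma (in abelian_monoid) finsum_delta:
  assumes "finite I" "i \<in> I" "f i \<in> carrier G" "\<And>j. j \<in> I \<Longrightarrow> j \<noteq> i \<Longrightarrow> f j = \<zero>"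
  shows "finsum G f I = f i"
proof -
  have "finsum G f I = finsum G (\<lambda>j. if i = j then f i else \<zero>) I"
    by (rule finsum_cong') (use assms in auto)
  also have "\<dots> = f i"
    using finsum_singleton[of i I "\<lambda>_. f i"] assms by simp
  finally show ?thesis .
qed

text \<open>The axiom \<open>direct_sum\<close> sums over the support of a family; over a finite
  group this passes to the sum over all of \<open>carrier G\<close>.\<close>

lemma (in abelian_monoid) finsum_support:
  assumes "finite I" and "\<And>i. i \<in> I \<Longrightarrow> f i \<in> carrier G"
  shows "finsum G f {i \<in> I. f i \<noteq> \<zero>} = finsum G f I"
  by (rule add.finprod_mono_neutral_cong_left) (use assms in auto)

text \<open>Left translation by \<open>g\<close> permutes the group. This is the change of variable
  in convolution sums.\<close>

lemma (in group) finsum_translate: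
  assumes H: "abelian_monoid H" and g: "g \<in> carrier G"
    and f: "\<And>k. k \<in> carrier G \<Longrightarrow> f k \<in> carrier H"
  shows "finsum H (\<lambda>k. f (g \<otimes> k)) (carrier G) = finsum H f (carrier G)"
proof -
  interpret H: abelian_monoid H by (rule H)
  have *: "(\<lambda>k. g \<otimes> k) ` carrier G = carrier G"
    using g by (intro surj_const_mult)
  show ?thesis
    using H.finsum_reindex[of f "\<lambda>k. g \<otimes> k" "carrier G"] g f
    by (simp add: * inj_on_multc inj_on_cmult Pi_def)
qed

section \<open>Scalars, algebra homomorphisms and automorphisms\<close>

lemma (in complex_algebra) scalar_closed [simp]: "x \<in> carrier B \<Longrightarrow> c \<odot>\<^bsub>B\<^esub> x \<in> carrier B"
  by (rule smult_closed) (auto simp: ring_of_type_algebra_def)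

lemma (in complex_algebra) scalar_finsum:
  assumes "finite I" "\<And>i. i \<in> I \<Longrightarrow> f i \<in> carrier B"
  shows "c \<odot>\<^bsub>B\<^esub> finsum B f I = finsum B (\<lambda>i. c \<odot>\<^bsub>B\<^esub> f i) I"
  by (rule finsum_smult_ldistr) (use assms in \<open>auto simp: ring_of_type_algebra_def\<close>)

lemma alg_hom_ring_hom: "f \<in> alg_hom A B \<Longrightarrow> f \<in> ring_hom A B"
  by (simp add: alg_hom_def)

lemma alg_hom_smult: "f \<in> alg_hom A B \<Longrightarrow> x \<in> carrier A \<Longrightarrow> f (c \<odot>\<^bsub>A\<^esub> x) = c \<odot>\<^bsub>B\<^esub> f x"
  by (simp add: alg_hom_def)

lemma carrier_alg_Aut: "carrier (alg_Aut B) = alg_iso B B \<inter> Bij (carrier B)"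
  by (simp add: alg_Aut_def)

lemma mult_alg_Aut:
  assumes "f \<in> Bij (carrier B)" "g \<in> Bij (carrier B)"
  shows "f \<otimes>\<^bsub>alg_Aut B\<^esub> g = compose (carrier B) f g"
  using assms by (simp add: alg_Aut_def BijGroup_def)

text \<open>Bijectivity comes from \<open>mult\<close> and \<open>one\<close>: the value of
  \<open>S\<close> at the inverse of \<open>g\<close> is a two-sided inverse of \<open>S g\<close>.
  The extensionality conditions match the conventions of \<open>hom_gr\<close> and
  \<open>Bij\<close>.\<close>

lemma hom_gr_alg_AutI:
  assumes "group G"
    and alg: "\<And>g. g \<in> carrier G \<Longrightarrow> S g \<in> alg_hom B B"
    and ext: "S \<in> extensional (carrier G)"
      "\<And>g. g \<in> carrier G \<Longrightarrow> S g \<in> extensional (carrier B)"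
    and mult: "\<And>g h b. g \<in> carrier G \<Longrightarrow> h \<in> carrier G \<Longrightarrow> b \<in> carrier B \<Longrightarrow>
      S (g \<otimes>\<^bsub>G\<^esub> h) b = S g (S h b)"
    and one: "\<And>b. b \<in> carrier B \<Longrightarrow> S \<one>\<^bsub>G\<^esub> b = b"
  shows "S \<in> hom_gr G (alg_Aut B)"
proof -
  interpret G: group G by (rule assms)
  have closed: "S g b \<in> carrier B" if "g \<in> carrier G" "b \<in> carrier B" for g b
    using alg[OF that(1)] that(2) by (auto simp: alg_hom_def ring_hom_def)
  have bij: "bij_betw (S g) (carrier B) (carrier B)" if g: "g \<in> carrier G" for g
  proof (rule bij_betwI[where g = "S (inv\<^bsub>G\<^esub> g)"])
    show "S (inv\<^bsub>G\<^esub> g) (S g b) = b" if "b \<in> carrier B" for b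
      using mult[of "inv\<^bsub>G\<^esub> g" g b] one g that by simp
    show "S g (S (inv\<^bsub>G\<^esub> g) b) = b" if "b \<in> carrier B" for b
      using mult[of g "inv\<^bsub>G\<^esub> g" b] one g that by simp
  qed (use g closed in auto)
  have Bij: "S g \<in> Bij (carrier B)" if "g \<in> carrier G" for g
    using bij ext that by (simp add: Bij_def)
  have "S \<in> hom G (alg_Aut B)"
  proof (rule homI)
    show "S g \<in> carrier (alg_Aut B)" if "g \<in> carrier G" for g
      using alg bij Bij that by (simp add: carrier_alg_Aut alg_iso_def)
    show "S (g \<otimes>\<^bsub>G\<^esub> h) = S g \<otimes>\<^bsub>alg_Aut B\<^esub> S h" if "g \<in> carrier G" "h \<in> carrier G" for g h
      unfolding mult_alg_Aut[OF Bij[OF that(1)] Bij[OF that(2)]]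
      by (rule extensionalityI[of _ "carrier B"])
        (use that ext mult in \<open>auto simp: compose_def\<close>)
  qed
  then show ?thesis using ext by (simp add: hom_gr_def)
qed

section \<open>The twisted algebra as a crossed product\<close>

locale algebra_action =
  G: group G + B: complex_algebra B
  for G :: "('g, 'm) monoid_scheme"
    and B :: "(complex, 'b, 'k) module_scheme" +
  fixes S :: "'g \<Rightarrow> 'b \<Rightarrow> 'b"
  assumes finite_group: "finite (carrier G)"
    and S_hom_gr: "S \<in> hom_gr G (alg_Aut B)"
begin

lemma S_Aut: "g \<in> carrier G \<Longrightarrow> S g \<in> alg_iso B B \<inter> Bij (carrier B)"
  using S_hom_gr by (auto simp: hom_gr_def hom_def carrier_alg_Aut)

lemma S_Bij: "g \<in> carrier G \<Longrightarrow> S g \<in> Bij (carrier B)"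
  using S_Aut by blast

lemma S_ring_hom: "g \<in> carrier G \<Longrightarrow> S g \<in> ring_hom B B"
  using S_Aut by (auto simp: alg_iso_def alg_hom_def)

lemma S_closed [simp]: "g \<in> carrier G \<Longrightarrow> b \<in> carrier B \<Longrightarrow> S g b \<in> carrier B"
  using ring_hom_closed[OF S_ring_hom] .

lemma S_zero [simp]: "g \<in> carrier G \<Longrightarrow> S g \<zero>\<^bsub>B\<^esub> = \<zero>\<^bsub>B\<^esub>"
  using ring_hom_zero[OF S_ring_hom B.ring_axioms B.ring_axioms] .

lemma S_one [simp]: "g \<in> carrier G \<Longrightarrow> S g \<one>\<^bsub>B\<^esub> = \<one>\<^bsub>B\<^esub>"
  using ring_hom_one[OF S_ring_hom] .

lemma S_add:
  "g \<in> carrier G \<Longrightarrow> a \<in> carrier B \<Longrightarrow> b \<in> carrier B \<Longrightarrow> S g (a \<oplus>\<^bsub>B\<^esub> b) = S g a \<oplus>\<^bsub>B\<^esub> S g b"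
  using ring_hom_add[OF S_ring_hom] .

lemma S_mult:
  "g \<in> carrier G \<Longrightarrow> a \<in> carrier B \<Longrightarrow> b \<in> carrier B \<Longrightarrow> S g (a \<otimes>\<^bsub>B\<^esub> b) = S g a \<otimes>\<^bsub>B\<^esub> S g b"
  using ring_hom_mult[OF S_ring_hom] .

lemma S_smult: "g \<in> carrier G \<Longrightarrow> b \<in> carrier B \<Longrightarrow> S g (c \<odot>\<^bsub>B\<^esub> b) = c \<odot>\<^bsub>B\<^esub> S g b"
  using S_Aut by (auto simp: alg_iso_def alg_hom_def)

lemma S_comp:
  assumes "g \<in> carrier G" "h \<in> carrier G" "b \<in> carrier B"
  shows "S (g \<otimes>\<^bsub>G\<^esub> h) b = S g (S h b)"
proof -
  have "S (g \<otimes>\<^bsub>G\<^esub> h) = S g \<otimes>\<^bsub>alg_Aut B\<^esub> S h"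
    using S_hom_gr assms by (auto simp: hom_gr_def hom_def)
  then show ?thesis
    using assms by (simp add: mult_alg_Aut S_Bij compose_def)
qed

text \<open>\<open>S\<close> at the identity is idempotent and injective, hence the identity on
  \<open>carrier B\<close>. No group structure on \<open>alg_Aut B\<close> has to be established for
  this.\<close>

lemma S_group_one [simp]:
  assumes "b \<in> carrier B"
  shows "S \<one>\<^bsub>G\<^esub> b = b"
proof -
  have "inj_on (S \<one>\<^bsub>G\<^esub>) (carrier B)"
    using S_Bij[of "\<one>\<^bsub>G\<^esub>"] by (simp add: Bij_def bij_betw_def)
  moreover have "S \<one>\<^bsub>G\<^esub> (S \<one>\<^bsub>G\<^esub> b) = S \<one>\<^bsub>G\<^esub> b"
    using S_comp[of "\<one>\<^bsub>G\<^esub>" "\<one>\<^bsub>G\<^esub>" b] assms by simp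
  ultimately show ?thesis
    using assms by (simp add: inj_on_def)
qed

lemma S_finsum:
  assumes "g \<in> carrier G" "finite I" "\<And>i. i \<in> I \<Longrightarrow> f i \<in> carrier B"
  shows "S g (finsum B f I) = finsum B (\<lambda>i. S g (f i)) I"
  using assms by (intro B.finsum_additive B.abelian_monoid_axioms) (auto simp: S_add)

section \<open>The twisted algebra as an associative complex algebra\<close>

abbreviation AS where "AS \<equiv> twisted_algebra G B S"

lemma carrier_AS: "carrier AS = carrier G \<rightarrow>\<^sub>E carrier B"
  by (simp add: twisted_algebra_def)

lemma AS_closed [simp]: "x \<in> carrier AS \<Longrightarrow> k \<in> carrier G \<Longrightarrow> x k \<in> carrier B"
  by (auto simp: carrier_AS)

lemma AS_eqI:
  "x \<in> carrier AS \<Longrightarrow> y \<in> carrier AS \<Longrightarrow> (\<And>k. k \<in> carrier G \<Longrightarrow> x k = y k) \<Longrightarrow> x = y"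
  unfolding carrier_AS by (rule PiE_ext)

lemma AS_zero: "\<zero>\<^bsub>AS\<^esub> = (\<lambda>k\<in>carrier G. \<zero>\<^bsub>B\<^esub>)"
  and AS_one: "\<one>\<^bsub>AS\<^esub> = monomial G B \<one>\<^bsub>B\<^esub> \<one>\<^bsub>G\<^esub>"
  and AS_add: "x \<oplus>\<^bsub>AS\<^esub> y = (\<lambda>k\<in>carrier G. x k \<oplus>\<^bsub>B\<^esub> y k)"
  and AS_smult: "c \<odot>\<^bsub>AS\<^esub> x = (\<lambda>k\<in>carrier G. c \<odot>\<^bsub>B\<^esub> x k)"
  and AS_component: "component AS g = (\<lambda>b. monomial G B b g) ` carrier B"
  and AS_embed: "embed AS b = monomial G B b \<one>\<^bsub>G\<^esub>"
  by (simp_all add: twisted_algebra_def)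

text \<open>The pairs with product \<open>k\<close> are parametrised by their first entry, the
  second being determined. The product thus becomes a twisted convolution over
  \<open>carrier G\<close>, the form used in all later computations.\<close>

lemma AS_mult_apply:
  assumes x: "x \<in> carrier AS" and y: "y \<in> carrier AS" and k: "k \<in> carrier G"
  shows "(x \<otimes>\<^bsub>AS\<^esub> y) k = (\<Oplus>\<^bsub>B\<^esub>g\<in>carrier G. x g \<otimes>\<^bsub>B\<^esub> S g (y (inv\<^bsub>G\<^esub> g \<otimes>\<^bsub>G\<^esub> k)))"
proof -
  let ?F = "\<lambda>(g, h). x g \<otimes>\<^bsub>B\<^esub> S g (y h)"
  have im: "{(g, h) \<in> carrier G \<times> carrier G. g \<otimes>\<^bsub>G\<^esub> h = k}
    = (\<lambda>g. (g, inv\<^bsub>G\<^esub> g \<otimes>\<^bsub>G\<^esub> k)) ` carrier G"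
    using k by (auto simp: image_iff G.inv_solve_left G.m_assoc[symmetric])
  have "(x \<otimes>\<^bsub>AS\<^esub> y) k = finsum B ?F ((\<lambda>g. (g, inv\<^bsub>G\<^esub> g \<otimes>\<^bsub>G\<^esub> k)) ` carrier G)"
    using k by (simp add: twisted_algebra_def flip: im)
  also have "\<dots> = finsum B (\<lambda>g. ?F (g, inv\<^bsub>G\<^esub> g \<otimes>\<^bsub>G\<^esub> k)) (carrier G)"
    using x y k by (intro B.finsum_reindex) (auto simp: inj_on_def)
  finally show ?thesis by simp
qed

lemma AS_mult_closed: "x \<in> carrier AS \<Longrightarrow> y \<in> carrier AS \<Longrightarrow> x \<otimes>\<^bsub>AS\<^esub> y \<in> carrier AS"
proof -
  assume x: "x \<in> carrier AS" and y: "y \<in> carrier AS"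
  have "(x \<otimes>\<^bsub>AS\<^esub> y) k \<in> carrier B" if "k \<in> carrier G" for k
    unfolding AS_mult_apply[OF x y that] using x y that by (intro B.finsum_closed) auto
  moreover have "x \<otimes>\<^bsub>AS\<^esub> y \<in> extensional (carrier G)"
    by (simp add: twisted_algebra_def)
  ultimately show ?thesis by (auto simp: carrier_AS PiE_def)
qed

lemma monomial_AS: "b \<in> carrier B \<Longrightarrow> monomial G B b g \<in> carrier AS"
  by (auto simp: carrier_AS monomial_def)

text \<open>Both sides are sums over the degree \<open>a\<close> of the factor from \<open>x\<close>
  and a second degree. On the left that second degree is the total degree \<open>g\<close> of the
  factors from \<open>x\<close> and \<open>y\<close>, on the right it is the degree \<open>c\<close>
  of the factor from \<open>y\<close>.\<close>

lemma AS_mult_assoc: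
  assumes x: "x \<in> carrier AS" and y: "y \<in> carrier AS" and z: "z \<in> carrier AS"
  shows "x \<otimes>\<^bsub>AS\<^esub> y \<otimes>\<^bsub>AS\<^esub> z = x \<otimes>\<^bsub>AS\<^esub> (y \<otimes>\<^bsub>AS\<^esub> z)"
proof (rule AS_eqI)
  fix k assume k: "k \<in> carrier G"
  let ?f = "\<lambda>a g. x a \<otimes>\<^bsub>B\<^esub> S a (y (inv\<^bsub>G\<^esub> a \<otimes>\<^bsub>G\<^esub> g)) \<otimes>\<^bsub>B\<^esub> S g (z (inv\<^bsub>G\<^esub> g \<otimes>\<^bsub>G\<^esub> k))"
  note [simp] = x y z k finite_group AS_mult_closed
  have "(x \<otimes>\<^bsub>AS\<^esub> y \<otimes>\<^bsub>AS\<^esub> z) k = (\<Oplus>\<^bsub>B\<^esub>g\<in>carrier G. \<Oplus>\<^bsub>B\<^esub>a\<in>carrier G. ?f a g)"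
    by (simp add: AS_mult_apply, intro B.finsum_cong' refl)
      (auto simp: AS_mult_apply intro!: B.finsum_ldistr B.finsum_closed)
  also have "\<dots> = (\<Oplus>\<^bsub>B\<^esub>a\<in>carrier G. \<Oplus>\<^bsub>B\<^esub>g\<in>carrier G. ?f a g)"
    by (rule B.finsum_swap) auto
  also have "\<dots> = (\<Oplus>\<^bsub>B\<^esub>a\<in>carrier G. x a \<otimes>\<^bsub>B\<^esub> S a ((y \<otimes>\<^bsub>AS\<^esub> z) (inv\<^bsub>G\<^esub> a \<otimes>\<^bsub>G\<^esub> k)))"
  proof (intro B.finsum_cong' refl)
    fix a assume a: "a \<in> carrier G"
    \<comment> \<open>For fixed \<open>a\<close>, substitute the product of \<open>a\<close> and
      \<open>c\<close> for \<open>g\<close>; \<open>S_comp\<close> then lets \<open>S a\<close> be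
      pulled out of the summand.\<close>
    have "(\<Oplus>\<^bsub>B\<^esub>g\<in>carrier G. ?f a g) = (\<Oplus>\<^bsub>B\<^esub>c\<in>carrier G. ?f a (a \<otimes>\<^bsub>G\<^esub> c))"
      by (rule G.finsum_translate[symmetric]) (use a B.abelian_monoid_axioms in auto)
    also have "\<dots> = (\<Oplus>\<^bsub>B\<^esub>c\<in>carrier G. x a \<otimes>\<^bsub>B\<^esub>
        S a (y c \<otimes>\<^bsub>B\<^esub> S c (z (inv\<^bsub>G\<^esub> c \<otimes>\<^bsub>G\<^esub> (inv\<^bsub>G\<^esub> a \<otimes>\<^bsub>G\<^esub> k)))))"
    proof (intro B.finsum_cong' refl)
      fix c assume c: "c \<in> carrier G"
      have "inv\<^bsub>G\<^esub> a \<otimes>\<^bsub>G\<^esub> (a \<otimes>\<^bsub>G\<^esub> c) = c"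
        using a c by (simp flip: G.m_assoc)
      then show "?f a (a \<otimes>\<^bsub>G\<^esub> c) = x a \<otimes>\<^bsub>B\<^esub>
        S a (y c \<otimes>\<^bsub>B\<^esub> S c (z (inv\<^bsub>G\<^esub> c \<otimes>\<^bsub>G\<^esub> (inv\<^bsub>G\<^esub> a \<otimes>\<^bsub>G\<^esub> k))))"
        using a c by (simp add: S_mult S_comp B.m_assoc G.m_assoc G.inv_mult_group)
    qed (use a in auto)
    also have "\<dots> = x a \<otimes>\<^bsub>B\<^esub> S a ((y \<otimes>\<^bsub>AS\<^esub> z) (inv\<^bsub>G\<^esub> a \<otimes>\<^bsub>G\<^esub> k))"
      using a by (subst B.finsum_rdistr[symmetric]) (auto simp: AS_mult_apply S_finsum)
    finally show "(\<Oplus>\<^bsub>B\<^esub>g\<in>carrier G. ?f a g)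
      = x a \<otimes>\<^bsub>B\<^esub> S a ((y \<otimes>\<^bsub>AS\<^esub> z) (inv\<^bsub>G\<^esub> a \<otimes>\<^bsub>G\<^esub> k))" .
  qed auto
  also have "\<dots> = (x \<otimes>\<^bsub>AS\<^esub> (y \<otimes>\<^bsub>AS\<^esub> z)) k"
    by (simp add: AS_mult_apply[of x])
  finally show "(x \<otimes>\<^bsub>AS\<^esub> y \<otimes>\<^bsub>AS\<^esub> z) k = (x \<otimes>\<^bsub>AS\<^esub> (y \<otimes>\<^bsub>AS\<^esub> z)) k" .
qed (use x y z AS_mult_closed in auto)

lemma AS_abelian_group: "abelian_group AS"
proof (rule abelian_groupI)
  fix x assume x: "x \<in> carrier AS"
  show "\<exists>y\<in>carrier AS. y \<oplus>\<^bsub>AS\<^esub> x = \<zero>\<^bsub>AS\<^esub>"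
    by (rule bexI[of _ "\<lambda>k\<in>carrier G. \<ominus>\<^bsub>B\<^esub> x k"])
      (use x in \<open>auto simp: AS_add AS_zero carrier_AS B.l_neg intro!: restrict_ext\<close>)
  show "\<zero>\<^bsub>AS\<^esub> \<oplus>\<^bsub>AS\<^esub> x = x"
    by (rule AS_eqI) (use x in \<open>auto simp: AS_add AS_zero carrier_AS\<close>)
qed (auto simp: AS_add AS_zero carrier_AS B.a_ac intro!: restrict_ext)

lemma monomial_apply [simp]:
  "k \<in> carrier G \<Longrightarrow> monomial G B b g k = (if k = g then b else \<zero>\<^bsub>B\<^esub>)"
  by (simp add: monomial_def)

lemma AS_monoid: "monoid AS"
proof (rule monoidI)
  fix x assume x: "x \<in> carrier AS"
  have one: "\<one>\<^bsub>AS\<^esub> \<in> carrier AS" by (simp add: AS_one monomial_AS)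
  show "\<one>\<^bsub>AS\<^esub> \<otimes>\<^bsub>AS\<^esub> x = x"
  proof (rule AS_eqI)
    fix k assume k: "k \<in> carrier G"
    have "(\<one>\<^bsub>AS\<^esub> \<otimes>\<^bsub>AS\<^esub> x) k
      = \<one>\<^bsub>AS\<^esub> \<one>\<^bsub>G\<^esub> \<otimes>\<^bsub>B\<^esub> S \<one>\<^bsub>G\<^esub> (x (inv\<^bsub>G\<^esub> \<one>\<^bsub>G\<^esub> \<otimes>\<^bsub>G\<^esub> k))"
      unfolding AS_mult_apply[OF one x k]
      \<comment> \<open>The unit is supported at the identity, so only the summand at the identity
        survives.\<close>
      by (rule B.finsum_delta) (use x k finite_group one in \<open>auto simp: AS_one\<close>)
    then show "(\<one>\<^bsub>AS\<^esub> \<otimes>\<^bsub>AS\<^esub> x) k = x k" using x k by (simp add: AS_one)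
  qed (use x one AS_mult_closed in auto)
  show "x \<otimes>\<^bsub>AS\<^esub> \<one>\<^bsub>AS\<^esub> = x"
  proof (rule AS_eqI)
    fix k assume k: "k \<in> carrier G"
    have "(x \<otimes>\<^bsub>AS\<^esub> \<one>\<^bsub>AS\<^esub>) k = x k \<otimes>\<^bsub>B\<^esub> S k (\<one>\<^bsub>AS\<^esub> (inv\<^bsub>G\<^esub> k \<otimes>\<^bsub>G\<^esub> k))"
      unfolding AS_mult_apply[OF x one k]
    \<comment> \<open>Now the second factor is the unit, evaluated at the quotient of
      \<open>k\<close> by the summation index; only the index \<open>k\<close> contributes.\<close>
    proof (rule B.finsum_delta)
      fix j assume j: "j \<in> carrier G" "j \<noteq> k"
      have "inv\<^bsub>G\<^esub> j \<otimes>\<^bsub>G\<^esub> k \<noteq> \<one>\<^bsub>G\<^esub>"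
        using j k by (metis G.inv_equality G.inv_inv G.inv_closed)
      then show "x j \<otimes>\<^bsub>B\<^esub> S j (\<one>\<^bsub>AS\<^esub> (inv\<^bsub>G\<^esub> j \<otimes>\<^bsub>G\<^esub> k)) = \<zero>\<^bsub>B\<^esub>"
        using x j k by (simp add: AS_one)
    qed (use x k finite_group one in auto)
    then show "(x \<otimes>\<^bsub>AS\<^esub> \<one>\<^bsub>AS\<^esub>) k = x k" using x k by (simp add: AS_one)
  qed (use x one AS_mult_closed in auto)
qed (auto simp: AS_mult_closed AS_mult_assoc AS_one monomial_AS)

lemma AS_add_closed: "x \<in> carrier AS \<Longrightarrow> y \<in> carrier AS \<Longrightarrow> x \<oplus>\<^bsub>AS\<^esub> y \<in> carrier AS"
  using abelian_groupE(1)[OF AS_abelian_group] .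

lemma AS_smult_closed: "x \<in> carrier AS \<Longrightarrow> c \<odot>\<^bsub>AS\<^esub> x \<in> carrier AS"
  by (auto simp: AS_smult carrier_AS)

lemma AS_ring: "ring AS"
proof (rule ringI[OF AS_abelian_group AS_monoid])
  fix x y z assume x: "x \<in> carrier AS" and y: "y \<in> carrier AS" and z: "z \<in> carrier AS"
  note [simp] = x y z AS_add_closed AS_mult_closed
  show "(x \<oplus>\<^bsub>AS\<^esub> y) \<otimes>\<^bsub>AS\<^esub> z = x \<otimes>\<^bsub>AS\<^esub> z \<oplus>\<^bsub>AS\<^esub> y \<otimes>\<^bsub>AS\<^esub> z"
  proof (rule AS_eqI)
    fix k assume k: "k \<in> carrier G"
    let ?t = "\<lambda>x g. x g \<otimes>\<^bsub>B\<^esub> S g (z (inv\<^bsub>G\<^esub> g \<otimes>\<^bsub>G\<^esub> k))"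
    have "((x \<oplus>\<^bsub>AS\<^esub> y) \<otimes>\<^bsub>AS\<^esub> z) k = (\<Oplus>\<^bsub>B\<^esub>g\<in>carrier G. ?t x g \<oplus>\<^bsub>B\<^esub> ?t y g)"
      unfolding AS_mult_apply[OF AS_add_closed[OF x y] z k]
      by (intro B.finsum_cong' refl) (use k in \<open>auto simp: AS_add B.l_distr\<close>)
    also have "\<dots> = finsum B (?t x) (carrier G) \<oplus>\<^bsub>B\<^esub> finsum B (?t y) (carrier G)"
      by (rule B.finsum_addf) (use k in auto)
    finally show "((x \<oplus>\<^bsub>AS\<^esub> y) \<otimes>\<^bsub>AS\<^esub> z) k = (x \<otimes>\<^bsub>AS\<^esub> z \<oplus>\<^bsub>AS\<^esub> y \<otimes>\<^bsub>AS\<^esub> z) k"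
      using k by (simp add: AS_mult_apply AS_add[of "x \<otimes>\<^bsub>AS\<^esub> z"])
  qed auto
  show "z \<otimes>\<^bsub>AS\<^esub> (x \<oplus>\<^bsub>AS\<^esub> y) = z \<otimes>\<^bsub>AS\<^esub> x \<oplus>\<^bsub>AS\<^esub> z \<otimes>\<^bsub>AS\<^esub> y"
  proof (rule AS_eqI)
    fix k assume k: "k \<in> carrier G"
    let ?t = "\<lambda>x g. z g \<otimes>\<^bsub>B\<^esub> S g (x (inv\<^bsub>G\<^esub> g \<otimes>\<^bsub>G\<^esub> k))"
    have "(z \<otimes>\<^bsub>AS\<^esub> (x \<oplus>\<^bsub>AS\<^esub> y)) k = (\<Oplus>\<^bsub>B\<^esub>g\<in>carrier G. ?t x g \<oplus>\<^bsub>B\<^esub> ?t y g)"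
      unfolding AS_mult_apply[OF z AS_add_closed[OF x y] k]
      by (intro B.finsum_cong' refl) (use k in \<open>auto simp: AS_add S_add B.r_distr\<close>)
    also have "\<dots> = finsum B (?t x) (carrier G) \<oplus>\<^bsub>B\<^esub> finsum B (?t y) (carrier G)"
      by (rule B.finsum_addf) (use k in auto)
    finally show "(z \<otimes>\<^bsub>AS\<^esub> (x \<oplus>\<^bsub>AS\<^esub> y)) k = (z \<otimes>\<^bsub>AS\<^esub> x \<oplus>\<^bsub>AS\<^esub> z \<otimes>\<^bsub>AS\<^esub> y) k"
      using k by (simp add: AS_mult_apply AS_add[of "z \<otimes>\<^bsub>AS\<^esub> x"])
  qed auto
qed

lemma AS_complex_algebra: "complex_algebra AS"
proof (intro complex_algebra.intro AS_ring)
  show "module complex_ring AS"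
  proof (intro module.intro AS_abelian_group module_axioms.intro)
    show "cring complex_ring" by (rule B.R.is_cring)
    fix c :: complex and d x y assume x: "x \<in> carrier AS" and y: "y \<in> carrier AS"
    show "c \<odot>\<^bsub>AS\<^esub> x \<in> carrier AS" using x by (rule AS_smult_closed)
    have C: "z \<in> carrier complex_ring" for z by (simp add: ring_of_type_algebra_def)
    note [simp] = C
    show "(c \<oplus>\<^bsub>complex_ring\<^esub> d) \<odot>\<^bsub>AS\<^esub> x = c \<odot>\<^bsub>AS\<^esub> x \<oplus>\<^bsub>AS\<^esub> d \<odot>\<^bsub>AS\<^esub> x"
      using x by (auto simp: AS_smult AS_add B.smult_l_distr intro!: restrict_ext)
    show "c \<odot>\<^bsub>AS\<^esub> (x \<oplus>\<^bsub>AS\<^esub> y) = c \<odot>\<^bsub>AS\<^esub> x \<oplus>\<^bsub>AS\<^esub> c \<odot>\<^bsub>AS\<^esub> y"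
      using x y by (auto simp: AS_smult AS_add B.smult_r_distr intro!: restrict_ext)
    show "(c \<otimes>\<^bsub>complex_ring\<^esub> d) \<odot>\<^bsub>AS\<^esub> x = c \<odot>\<^bsub>AS\<^esub> (d \<odot>\<^bsub>AS\<^esub> x)"
      using x by (auto simp: AS_smult B.smult_assoc1 intro!: restrict_ext)
    show "\<one>\<^bsub>complex_ring\<^esub> \<odot>\<^bsub>AS\<^esub> x = x"
      by (rule AS_eqI) (use x AS_smult_closed in \<open>auto simp: AS_smult\<close>)
  qed
  show "complex_algebra_axioms AS"
  proof
    fix x y c assume x: "x \<in> carrier AS" and y: "y \<in> carrier AS"
    note [simp] = x y AS_smult_closed AS_mult_closed finite_group
    show "(c \<odot>\<^bsub>AS\<^esub> x) \<otimes>\<^bsub>AS\<^esub> y = c \<odot>\<^bsub>AS\<^esub> (x \<otimes>\<^bsub>AS\<^esub> y)"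
    proof (rule AS_eqI)
      fix k assume "k \<in> carrier G"
      then show "((c \<odot>\<^bsub>AS\<^esub> x) \<otimes>\<^bsub>AS\<^esub> y) k = (c \<odot>\<^bsub>AS\<^esub> (x \<otimes>\<^bsub>AS\<^esub> y)) k"
        by (simp add: AS_mult_apply AS_smult[of c "x \<otimes>\<^bsub>AS\<^esub> y"] B.scalar_finsum)
          (auto simp: AS_smult B.smult_mult_left intro!: B.finsum_cong')
    qed auto
    show "x \<otimes>\<^bsub>AS\<^esub> (c \<odot>\<^bsub>AS\<^esub> y) = c \<odot>\<^bsub>AS\<^esub> (x \<otimes>\<^bsub>AS\<^esub> y)"
    proof (rule AS_eqI)
      fix k assume "k \<in> carrier G"
      then show "(x \<otimes>\<^bsub>AS\<^esub> (c \<odot>\<^bsub>AS\<^esub> y)) k = (c \<odot>\<^bsub>AS\<^esub> (x \<otimes>\<^bsub>AS\<^esub> y)) k"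
        by (simp add: AS_mult_apply AS_smult[of c "x \<otimes>\<^bsub>AS\<^esub> y"] B.scalar_finsum)
          (auto simp: AS_smult S_smult B.smult_mult_right intro!: B.finsum_cong')
    qed auto
  qed
qed

lemma AS_finsum_apply:
  assumes "finite I" "\<And>i. i \<in> I \<Longrightarrow> F i \<in> carrier AS" "k \<in> carrier G"
  shows "finsum AS F I k = finsum B (\<lambda>i. F i k) I"
proof -
  interpret A: complex_algebra AS by (rule AS_complex_algebra)
  show ?thesis
    by (rule A.finsum_additive[where h = "\<lambda>x. x k"])
      (use assms B.abelian_monoid_axioms in \<open>auto simp: AS_zero AS_add\<close>)
qed

section \<open>Monomials and the grading of the twisted algebra\<close>

lemma monomial_mult:
  "g \<in> carrier G \<Longrightarrow> h \<in> carrier G \<Longrightarrow> b \<in> carrier B \<Longrightarrow> c \<in> carrier B \<Longrightarrow>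
    monomial G B b g \<otimes>\<^bsub>AS\<^esub> monomial G B c h = monomial G B (b \<otimes>\<^bsub>B\<^esub> S g c) (g \<otimes>\<^bsub>G\<^esub> h)"
  using B.complex_algebra_axioms G.group_axioms finite_group S_hom_gr
  by (rule twisted_algebra_mult_monomial)

lemma monomial_add:
  "b \<in> carrier B \<Longrightarrow> c \<in> carrier B \<Longrightarrow>
    monomial G B b g \<oplus>\<^bsub>AS\<^esub> monomial G B c g = monomial G B (b \<oplus>\<^bsub>B\<^esub> c) g"
  by (auto simp: AS_add monomial_def)

lemma monomial_smult: "c \<odot>\<^bsub>AS\<^esub> monomial G B b g = monomial G B (c \<odot>\<^bsub>B\<^esub> b) g"
  by (auto simp: AS_smult monomial_def ring_of_type_algebra_def intro!: B.smult_r_null)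

text \<open>Since \<open>S g\<close> fixes the unit of \<open>B\<close>, the basis elements multiply
  like the group elements, so the inverse of the one at \<open>g\<close> is the one at the inverse
  of \<open>g\<close>.\<close>

lemma monomial_unit:
  assumes g: "g \<in> carrier G"
  shows "monomial G B \<one>\<^bsub>B\<^esub> g \<in> Units AS"
  using g monomial_mult[of g "inv\<^bsub>G\<^esub> g" "\<one>\<^bsub>B\<^esub>" "\<one>\<^bsub>B\<^esub>"]
    monomial_mult[of "inv\<^bsub>G\<^esub> g" g "\<one>\<^bsub>B\<^esub>" "\<one>\<^bsub>B\<^esub>"]
  by (auto simp: Units_def AS_one intro!: monomial_AS bexI[of _ "monomial G B \<one>\<^bsub>B\<^esub> (inv\<^bsub>G\<^esub> g)"])

lemma monomial_eq_iff: "g \<in> carrier G \<Longrightarrow> monomial G B b g = monomial G B c g \<longleftrightarrow> b = c"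
  by (metis monomial_apply)

text \<open>The axioms on components and on \<open>embed\<close> reduce to the rules for monomials.
  The direct sum decomposition is obtained by evaluating coefficient functions pointwise.\<close>

lemma AS_crossed_product: "crossed_product G B AS"
proof (intro crossed_product.intro crossed_product_axioms.intro
    G.group_axioms B.complex_algebra_axioms AS_complex_algebra)
  interpret A: complex_algebra AS by (rule AS_complex_algebra)
  fix g assume g: "g \<in> carrier G"
  show "submodule (component AS g) complex_ring AS"
  proof (rule A.submoduleI)
    have zero: "monomial G B \<zero>\<^bsub>B\<^esub> g = \<zero>\<^bsub>AS\<^esub>"
      by (auto simp: AS_zero monomial_def)
    then show "\<zero>\<^bsub>AS\<^esub> \<in> component AS g"
      by (auto simp: AS_component intro!: image_eqI[of _ _ "\<zero>\<^bsub>B\<^esub>"])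
    fix x assume x: "x \<in> component AS g"
    then obtain b where b: "b \<in> carrier B" "x = monomial G B b g"
      by (auto simp: AS_component)
    have "\<ominus>\<^bsub>AS\<^esub> x = monomial G B (\<ominus>\<^bsub>B\<^esub> b) g"
      by (rule A.minus_equality)
        (use b zero in \<open>auto simp: monomial_add monomial_AS B.l_neg\<close>)
    then show "\<ominus>\<^bsub>AS\<^esub> x \<in> component AS g" using b by (auto simp: AS_component)
    show "c \<odot>\<^bsub>AS\<^esub> x \<in> component AS g" for c
      using b by (auto simp: AS_component monomial_smult)
    fix y assume y: "y \<in> component AS g"
    show "x \<oplus>\<^bsub>AS\<^esub> y \<in> component AS g"
      using b y by (auto simp: AS_component monomial_add)
  qed (auto simp: AS_component monomial_AS)
  show "component AS g \<inter> Units AS \<noteq> {}"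
    using monomial_unit[OF g] by (auto simp: AS_component)
next
  interpret A: complex_algebra AS by (rule AS_complex_algebra)
  fix x assume x: "x \<in> carrier AS"
  show "\<exists>!f. f \<in> (\<Pi>\<^sub>E g\<in>carrier G. component AS g) \<and> finite {g \<in> carrier G. f g \<noteq> \<zero>\<^bsub>AS\<^esub>} \<and>
    x = finsum AS f {g \<in> carrier G. f g \<noteq> \<zero>\<^bsub>AS\<^esub>}"
  \<comment> \<open>The homogeneous part of degree \<open>g\<close> is the coefficient
    \<open>x g\<close> times the basis element at \<open>g\<close>.\<close>
  proof (rule ex1I[of _ "\<lambda>g\<in>carrier G. monomial G B (x g) g"]; (elim conjE)?)
    let ?f = "\<lambda>g\<in>carrier G. monomial G B (x g) g"
    have "x = finsum AS ?f (carrier G)"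
    proof (rule AS_eqI)
      fix k assume k: "k \<in> carrier G"
      have "finsum AS ?f (carrier G) k = finsum B (\<lambda>g. ?f g k) (carrier G)"
        by (rule AS_finsum_apply) (use k x finite_group monomial_AS in auto)
      also have "\<dots> = ?f k k"
        by (rule B.finsum_delta) (use k x finite_group in auto)
      finally show "x k = finsum AS ?f (carrier G) k" using k by simp
    qed (use x monomial_AS in \<open>auto intro!: A.finsum_closed\<close>)
    also have "\<dots> = finsum AS ?f {g \<in> carrier G. ?f g \<noteq> \<zero>\<^bsub>AS\<^esub>}"
      by (rule A.finsum_support[symmetric]) (use x finite_group monomial_AS in auto)
    finally show "?f \<in> (\<Pi>\<^sub>E g\<in>carrier G. component AS g) \<and>
        finite {g \<in> carrier G. ?f g \<noteq> \<zero>\<^bsub>AS\<^esub>} \<and>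
        x = finsum AS ?f {g \<in> carrier G. ?f g \<noteq> \<zero>\<^bsub>AS\<^esub>}"
      using x finite_group by (auto simp: AS_component)
    fix f assume f: "f \<in> (\<Pi>\<^sub>E g\<in>carrier G. component AS g)"
      and eq: "x = finsum AS f {g \<in> carrier G. f g \<noteq> \<zero>\<^bsub>AS\<^esub>}"
    have fg: "\<exists>b\<in>carrier B. f g = monomial G B b g" if "g \<in> carrier G" for g
      using f that by (auto simp: AS_component)
    then have fA: "f g \<in> carrier AS" if "g \<in> carrier G" for g
      using that monomial_AS by metis
    have x_eq: "x = finsum AS f (carrier G)"
      unfolding eq by (rule A.finsum_support) (use fA finite_group in auto)
    \<comment> \<open>Uniqueness: at the point \<open>k\<close> every part of degree different from
      \<open>k\<close> vanishes, so \<open>x k\<close> determines \<open>f k\<close>.\<close>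
    have "f k = monomial G B (x k) k" if k: "k \<in> carrier G" for k
    proof -
      obtain b where b: "b \<in> carrier B" "f k = monomial G B b k" using fg k by blast
      have "x k = finsum B (\<lambda>g. f g k) (carrier G)"
        unfolding x_eq by (rule AS_finsum_apply) (use k fA finite_group in auto)
      also have "\<dots> = f k k"
      proof (rule B.finsum_delta)
        show "f j k = \<zero>\<^bsub>B\<^esub>" if "j \<in> carrier G" "j \<noteq> k" for j
          using fg[OF that(1)] that k by auto
      qed (use k fA finite_group in auto)
      finally show ?thesis using b k by simp
    qed
    then show "f = ?f"
      by (intro extensionalityI[of f "carrier G" ?f]) (use f in \<open>auto simp: PiE_def\<close>)
  qed
next
  fix g h x y assume "g \<in> carrier G" "h \<in> carrier G" "x \<in> component AS g" "y \<in> component AS h"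
  then show "x \<otimes>\<^bsub>AS\<^esub> y \<in> component AS (g \<otimes>\<^bsub>G\<^esub> h)"
    by (auto simp: AS_component monomial_mult)
next
  show "embed AS \<in> alg_hom B AS"
    by (auto simp: alg_hom_def AS_embed monomial_AS monomial_mult monomial_add AS_one
        monomial_smult intro!: ring_hom_memI)
  show "bij_betw (embed AS) (carrier B) (component AS \<one>\<^bsub>G\<^esub>)"
    by (auto simp: bij_betw_def inj_on_def AS_embed AS_component monomial_eq_iff)
qed

text \<open>The basis elements themselves form a multiplicative section.\<close>

lemma AS_split: "split_sequence G AS"
  unfolding split_sequence_def
proof (rule bexI[of _ "\<lambda>g. monomial G B \<one>\<^bsub>B\<^esub> g"])
  show "(\<lambda>g. monomial G B \<one>\<^bsub>B\<^esub> g) \<in> hom G (homogeneous_units G AS)"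
    using monomial_unit
    by (auto simp: homogeneous_units_def hom_def AS_component units_of_mult monomial_mult
        intro!: bexI)
qed (auto simp: AS_component)

end

section \<open>Crossed products with a covariant section\<close>

context crossed_product
begin

lemma component_closed: "g \<in> carrier G \<Longrightarrow> x \<in> component A g \<Longrightarrow> x \<in> carrier A"
  using A.submoduleE(1)[OF component_submodule] by blast

lemma embed_component: "b \<in> carrier B \<Longrightarrow> embed A b \<in> component A \<one>\<^bsub>G\<^esub>"
  using embed_bij by (auto simp: bij_betw_def)

lemma embed_closed [simp]: "b \<in> carrier B \<Longrightarrow> embed A b \<in> carrier A"
  using embed_component component_closed by blast

lemma embed_mult: "a \<in> carrier B \<Longrightarrow> b \<in> carrier B \<Longrightarrow>
    embed A (a \<otimes>\<^bsub>B\<^esub> b) = embed A a \<otimes>\<^bsub>A\<^esub> embed A b"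
  using ring_hom_mult[OF alg_hom_ring_hom[OF embed_hom]] .

lemma embed_add: "a \<in> carrier B \<Longrightarrow> b \<in> carrier B \<Longrightarrow>
    embed A (a \<oplus>\<^bsub>B\<^esub> b) = embed A a \<oplus>\<^bsub>A\<^esub> embed A b"
  using ring_hom_add[OF alg_hom_ring_hom[OF embed_hom]] .

lemma embed_one [simp]: "embed A \<one>\<^bsub>B\<^esub> = \<one>\<^bsub>A\<^esub>"
  using ring_hom_one[OF alg_hom_ring_hom[OF embed_hom]] .

lemma embed_zero [simp]: "embed A \<zero>\<^bsub>B\<^esub> = \<zero>\<^bsub>A\<^esub>"
  using ring_hom_zero[OF alg_hom_ring_hom[OF embed_hom] B.ring_axioms A.ring_axioms] .

lemma embed_eq_iff: "a \<in> carrier B \<Longrightarrow> b \<in> carrier B \<Longrightarrow> embed A a = embed A b \<longleftrightarrow> a = b"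
  using embed_bij by (auto simp: bij_betw_def inj_on_def)

lemma embed_finsum:
  assumes "finite I" "\<And>i. i \<in> I \<Longrightarrow> f i \<in> carrier B"
  shows "embed A (finsum B f I) = finsum A (\<lambda>i. embed A (f i)) I"
  using assms A.abelian_monoid_axioms by (intro B.finsum_additive) (auto simp: embed_add)

end

text \<open>Serves two purposes. For an abstract split \<open>A\<close>, \<open>\<sigma>\<close> is
  a splitting and \<open>S\<close> is conjugation by it; for the twisted algebra of one action,
  \<open>\<sigma>\<close> is a section covariant for another action.\<close>

locale covariant_section = crossed_product G B A + algebra_action G B S
  for G :: "('g, 'm) monoid_scheme"
    and B :: "(complex, 'b, 'k) module_scheme"
    and A :: "('g, 'b, 'a) graded_algebra"
    and S :: "'g \<Rightarrow> 'b \<Rightarrow> 'b" +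
  fixes \<sigma> :: "'g \<Rightarrow> 'a"
  assumes sec_component: "g \<in> carrier G \<Longrightarrow> \<sigma> g \<in> component A g"
    and sec_mult: "g \<in> carrier G \<Longrightarrow> h \<in> carrier G \<Longrightarrow> \<sigma> (g \<otimes>\<^bsub>G\<^esub> h) = \<sigma> g \<otimes>\<^bsub>A\<^esub> \<sigma> h"
    and sec_one: "\<sigma> \<one>\<^bsub>G\<^esub> = \<one>\<^bsub>A\<^esub>"
    and covariant: "g \<in> carrier G \<Longrightarrow> b \<in> carrier B \<Longrightarrow>
      \<sigma> g \<otimes>\<^bsub>A\<^esub> embed A b = embed A (S g b) \<otimes>\<^bsub>A\<^esub> \<sigma> g"
begin

lemma sec_closed [simp]: "g \<in> carrier G \<Longrightarrow> \<sigma> g \<in> carrier A"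
  using sec_component component_closed by blast

lemma sec_inv_left:
  assumes "g \<in> carrier G" "x \<in> carrier A"
  shows "x \<otimes>\<^bsub>A\<^esub> \<sigma> (inv\<^bsub>G\<^esub> g) \<otimes>\<^bsub>A\<^esub> \<sigma> g = x"
  using assms sec_mult[of "inv\<^bsub>G\<^esub> g" g] by (simp add: A.m_assoc sec_one flip: sec_mult)

lemma sec_inv_right:
  assumes "g \<in> carrier G" "x \<in> carrier A"
  shows "x \<otimes>\<^bsub>A\<^esub> \<sigma> g \<otimes>\<^bsub>A\<^esub> \<sigma> (inv\<^bsub>G\<^esub> g) = x"
  using assms sec_mult[of g "inv\<^bsub>G\<^esub> g"] by (simp add: A.m_assoc sec_one flip: sec_mult)

lemma embed_sec_eq_iff:
  assumes "g \<in> carrier G" "a \<in> carrier B" "b \<in> carrier B"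
  shows "embed A a \<otimes>\<^bsub>A\<^esub> \<sigma> g = embed A b \<otimes>\<^bsub>A\<^esub> \<sigma> g \<longleftrightarrow> a = b"
  using sec_inv_right[of g "embed A a"] sec_inv_right[of g "embed A b"] assms
  by (metis embed_closed embed_eq_iff)

lemma embed_sec_component:
  "g \<in> carrier G \<Longrightarrow> b \<in> carrier B \<Longrightarrow> embed A b \<otimes>\<^bsub>A\<^esub> \<sigma> g \<in> component A g"
  using component_mult[of "\<one>\<^bsub>G\<^esub>" g "embed A b" "\<sigma> g"] by (simp add: embed_component sec_component)

text \<open>Right multiplication by \<open>\<sigma>\<close> at the inverse of \<open>g\<close>
  carries degree \<open>g\<close> into degree one, which is the image of \<open>embed A\<close>.
  With \<open>embed_sec_eq_iff\<close>, each component is a free left \<open>B\<close>-module with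
  basis \<open>\<sigma> g\<close>.\<close>

lemma component_eq:
  assumes g: "g \<in> carrier G"
  shows "component A g = (\<lambda>b. embed A b \<otimes>\<^bsub>A\<^esub> \<sigma> g) ` carrier B"
proof (intro equalityI subsetI)
  fix x assume x: "x \<in> component A g"
  have "x \<otimes>\<^bsub>A\<^esub> \<sigma> (inv\<^bsub>G\<^esub> g) \<in> component A \<one>\<^bsub>G\<^esub>"
    using component_mult[OF g _ x, of "inv\<^bsub>G\<^esub> g"] g sec_component[of "inv\<^bsub>G\<^esub> g"] by simp
  then obtain b where "b \<in> carrier B" "x \<otimes>\<^bsub>A\<^esub> \<sigma> (inv\<^bsub>G\<^esub> g) = embed A b"
    using embed_bij by (auto simp: bij_betw_def)
  then show "x \<in> (\<lambda>b. embed A b \<otimes>\<^bsub>A\<^esub> \<sigma> g) ` carrier B"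
    using sec_inv_left[OF g component_closed[OF g x]] by force
qed (use g embed_sec_component in auto)

text \<open>The left \<open>B\<close>-linear map from the twisted algebra to \<open>A\<close> that
  sends the basis element at \<open>g\<close> to \<open>\<sigma> g\<close>.\<close>

definition assemble :: "('g \<Rightarrow> 'b) \<Rightarrow> 'a"
  where "assemble x = (\<Oplus>\<^bsub>A\<^esub>g\<in>carrier G. embed A (x g) \<otimes>\<^bsub>A\<^esub> \<sigma> g)"

lemma assemble_closed: "x \<in> carrier AS \<Longrightarrow> assemble x \<in> carrier A"
  unfolding assemble_def by (rule A.finsum_closed) auto

lemma assemble_monomial:
  assumes "g \<in> carrier G" "b \<in> carrier B"
  shows "assemble (monomial G B b g) = embed A b \<otimes>\<^bsub>A\<^esub> \<sigma> g"
proof -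
  have "assemble (monomial G B b g) = embed A (monomial G B b g g) \<otimes>\<^bsub>A\<^esub> \<sigma> g"
    unfolding assemble_def
    by (rule A.finsum_delta) (use assms finite_group in auto)
  then show ?thesis using assms by simp
qed

lemma assemble_add:
  assumes "x \<in> carrier AS" "y \<in> carrier AS"
  shows "assemble (x \<oplus>\<^bsub>AS\<^esub> y) = assemble x \<oplus>\<^bsub>A\<^esub> assemble y"
proof -
  have "assemble (x \<oplus>\<^bsub>AS\<^esub> y)
    = (\<Oplus>\<^bsub>A\<^esub>g\<in>carrier G. embed A (x g) \<otimes>\<^bsub>A\<^esub> \<sigma> g \<oplus>\<^bsub>A\<^esub> embed A (y g) \<otimes>\<^bsub>A\<^esub> \<sigma> g)"
    unfolding assemble_def
    by (rule A.finsum_cong') (use assms in \<open>auto simp: AS_add embed_add A.l_distr\<close>)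
  also have "\<dots> = assemble x \<oplus>\<^bsub>A\<^esub> assemble y"
    unfolding assemble_def by (rule A.finsum_addf) (use assms in auto)
  finally show ?thesis .
qed

lemma assemble_smult:
  assumes "x \<in> carrier AS"
  shows "assemble (c \<odot>\<^bsub>AS\<^esub> x) = c \<odot>\<^bsub>A\<^esub> assemble x"
proof -
  have "assemble (c \<odot>\<^bsub>AS\<^esub> x) = (\<Oplus>\<^bsub>A\<^esub>g\<in>carrier G. c \<odot>\<^bsub>A\<^esub> (embed A (x g) \<otimes>\<^bsub>A\<^esub> \<sigma> g))"
    unfolding assemble_def
    by (rule A.finsum_cong')
      (use assms in \<open>auto simp: AS_smult alg_hom_smult[OF embed_hom] A.smult_mult_left\<close>)
  also have "\<dots> = c \<odot>\<^bsub>A\<^esub> assemble x"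
    unfolding assemble_def
    by (rule A.scalar_finsum[symmetric]) (use assms finite_group in auto)
  finally show ?thesis .
qed

text \<open>Expand the convolution inside the sum, exchange the two sums, and regroup by the degree
  of the left factor; covariance of \<open>\<sigma>\<close> matches the twist by \<open>S\<close>
  with the product in \<open>A\<close>.\<close>

lemma assemble_mult:
  assumes x: "x \<in> carrier AS" and y: "y \<in> carrier AS"
  shows "assemble (x \<otimes>\<^bsub>AS\<^esub> y) = assemble x \<otimes>\<^bsub>A\<^esub> assemble y"
proof -
  let ?t = "\<lambda>g m. embed A (x g \<otimes>\<^bsub>B\<^esub> S g (y (inv\<^bsub>G\<^esub> g \<otimes>\<^bsub>G\<^esub> m))) \<otimes>\<^bsub>A\<^esub> \<sigma> m"
  let ?e = "\<lambda>x g. embed A (x g) \<otimes>\<^bsub>A\<^esub> \<sigma> g"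
  note [simp] = x y finite_group
  have "assemble (x \<otimes>\<^bsub>AS\<^esub> y) = (\<Oplus>\<^bsub>A\<^esub>m\<in>carrier G. \<Oplus>\<^bsub>A\<^esub>g\<in>carrier G. ?t g m)"
    unfolding assemble_def
  proof (intro A.finsum_cong' refl)
    fix m assume m: "m \<in> carrier G"
    show "embed A ((x \<otimes>\<^bsub>AS\<^esub> y) m) \<otimes>\<^bsub>A\<^esub> \<sigma> m = (\<Oplus>\<^bsub>A\<^esub>g\<in>carrier G. ?t g m)"
      using m by (subst AS_mult_apply, simp_all, subst embed_finsum)
        (auto intro!: A.finsum_ldistr)
  qed (auto intro!: A.finsum_closed)
  also have "\<dots> = (\<Oplus>\<^bsub>A\<^esub>g\<in>carrier G. \<Oplus>\<^bsub>A\<^esub>m\<in>carrier G. ?t g m)"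
    by (rule A.finsum_swap) auto
  also have "\<dots> = (\<Oplus>\<^bsub>A\<^esub>g\<in>carrier G. ?e x g \<otimes>\<^bsub>A\<^esub> assemble y)"
  proof (intro A.finsum_cong' refl)
    fix g assume g: "g \<in> carrier G"
    \<comment> \<open>Replace the total degree \<open>m\<close> by the product of \<open>g\<close>
      and \<open>k\<close>, where \<open>k\<close> is the degree of the factor from
      \<open>y\<close>.\<close>
    have "(\<Oplus>\<^bsub>A\<^esub>m\<in>carrier G. ?t g m) = (\<Oplus>\<^bsub>A\<^esub>k\<in>carrier G. ?t g (g \<otimes>\<^bsub>G\<^esub> k))"
      by (rule G.finsum_translate[symmetric]) (use g A.abelian_monoid_axioms in auto)
    also have "\<dots> = (\<Oplus>\<^bsub>A\<^esub>k\<in>carrier G. ?e x g \<otimes>\<^bsub>A\<^esub> ?e y k)"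
    proof (intro A.finsum_cong' refl)
      fix k assume k: "k \<in> carrier G"
      have "inv\<^bsub>G\<^esub> g \<otimes>\<^bsub>G\<^esub> (g \<otimes>\<^bsub>G\<^esub> k) = k"
        using g k by (simp flip: G.m_assoc)
      then have "?t g (g \<otimes>\<^bsub>G\<^esub> k)
        = embed A (x g) \<otimes>\<^bsub>A\<^esub> (embed A (S g (y k)) \<otimes>\<^bsub>A\<^esub> \<sigma> g) \<otimes>\<^bsub>A\<^esub> \<sigma> k"
        using g k by (simp add: embed_mult sec_mult A.m_assoc)
      \<comment> \<open>Covariance read from right to left moves \<open>\<sigma> g\<close> in front
        of the coefficient \<open>y k\<close>.\<close>
      also have "\<dots> = ?e x g \<otimes>\<^bsub>A\<^esub> ?e y k"
        using g k by (simp add: A.m_assoc flip: covariant)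
      finally show "?t g (g \<otimes>\<^bsub>G\<^esub> k) = ?e x g \<otimes>\<^bsub>A\<^esub> ?e y k" .
    qed (use g in auto)
    also have "\<dots> = ?e x g \<otimes>\<^bsub>A\<^esub> assemble y"
      unfolding assemble_def by (rule A.finsum_rdistr[symmetric]) (use g in auto)
    finally show "(\<Oplus>\<^bsub>A\<^esub>m\<in>carrier G. ?t g m) = ?e x g \<otimes>\<^bsub>A\<^esub> assemble y" .
  qed (auto simp: assemble_closed)
  also have "\<dots> = assemble x \<otimes>\<^bsub>A\<^esub> assemble y"
    unfolding assemble_def[of x]
    by (rule A.finsum_ldistr[symmetric]) (auto simp: assemble_closed)
  finally show ?thesis .
qed

text \<open>Injectivity is uniqueness of homogeneous decompositions together with cancellation of
  \<open>\<sigma> g\<close>. Surjectivity is their existence together with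
  \<open>component_eq\<close>.\<close>

lemma assemble_bij: "bij_betw assemble (carrier AS) (carrier A)"
  unfolding bij_betw_def
proof (intro conjI equalityI subsetI inj_onI)
  \<comment> \<open>\<open>?e x\<close> is the family of homogeneous parts of
    \<open>assemble x\<close>, and \<open>?P a f\<close> is the condition on \<open>f\<close> in
    \<open>direct_sum\<close>.\<close>
  let ?e = "\<lambda>x. \<lambda>g\<in>carrier G. embed A (x g) \<otimes>\<^bsub>A\<^esub> \<sigma> g"
  let ?P = "\<lambda>a f. f \<in> (\<Pi>\<^sub>E g\<in>carrier G. component A g) \<and>
    finite {g \<in> carrier G. f g \<noteq> \<zero>\<^bsub>A\<^esub>} \<and> a = finsum A f {g \<in> carrier G. f g \<noteq> \<zero>\<^bsub>A\<^esub>}"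
  have P: "?P (assemble x) (?e x)" if "x \<in> carrier AS" for x
  proof (intro conjI)
    have "finsum A (?e x) {g \<in> carrier G. ?e x g \<noteq> \<zero>\<^bsub>A\<^esub>} = finsum A (?e x) (carrier G)"
      by (rule A.finsum_support) (use that finite_group in auto)
    also have "\<dots> = assemble x"
      unfolding assemble_def by (rule A.finsum_cong') (use that in auto)
    finally show "assemble x = finsum A (?e x) {g \<in> carrier G. ?e x g \<noteq> \<zero>\<^bsub>A\<^esub>}" ..
  qed (use that finite_group embed_sec_component in auto)
  fix x y assume x: "x \<in> carrier AS" and y: "y \<in> carrier AS" and eq: "assemble x = assemble y"
  have "\<exists>\<^sub>\<le>\<^sub>1f. ?P (assemble y) f"
    using direct_sum[OF assemble_closed[OF y]] unfolding ex1_iff_ex_Uniq ..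
  then have e: "?e x = ?e y"
    by (rule Uniq_D) (use P[OF x] P[OF y] eq in simp_all)
  show "x = y"
  proof (rule AS_eqI[OF x y])
    fix k assume k: "k \<in> carrier G"
    then have "embed A (x k) \<otimes>\<^bsub>A\<^esub> \<sigma> k = embed A (y k) \<otimes>\<^bsub>A\<^esub> \<sigma> k"
      using fun_cong[OF e, of k] by simp
    then show "x k = y k" using embed_sec_eq_iff k x y by simp
  qed
next
  fix a assume "a \<in> carrier A"
  from direct_sum[OF this] obtain f where f: "f \<in> (\<Pi>\<^sub>E g\<in>carrier G. component A g)"
    and a: "a = finsum A f {g \<in> carrier G. f g \<noteq> \<zero>\<^bsub>A\<^esub>}" by blast
  have "\<forall>g\<in>carrier G. \<exists>b\<in>carrier B. f g = embed A b \<otimes>\<^bsub>A\<^esub> \<sigma> g"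
    using f component_eq by blast
  then obtain x where x: "\<And>g. g \<in> carrier G \<Longrightarrow> x g \<in> carrier B"
    "\<And>g. g \<in> carrier G \<Longrightarrow> f g = embed A (x g) \<otimes>\<^bsub>A\<^esub> \<sigma> g" by metis
  let ?x = "restrict x (carrier G)"
  have "a = finsum A f (carrier G)"
    unfolding a by (rule A.finsum_support) (use x finite_group in auto)
  also have "\<dots> = assemble ?x"
    unfolding assemble_def by (rule A.finsum_cong') (use x in auto)
  finally have "a = assemble ?x" .
  moreover have "?x \<in> carrier AS" using x by (simp add: carrier_AS)
  ultimately show "a \<in> assemble ` carrier AS" by (rule image_eqI)
qed (use assemble_closed in auto)

lemma equivalent_twisted_algebra: "equivalent G B AS A"
  unfolding equivalent_def
proof (intro bexI[of _ assemble] conjI ballI)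
  show "assemble \<in> alg_iso AS A"
    by (auto simp: alg_iso_def alg_hom_def assemble_bij assemble_closed assemble_mult assemble_add
        assemble_smult AS_one assemble_monomial sec_one intro!: ring_hom_memI)
  show "assemble ` component AS g = component A g" if "g \<in> carrier G" for g
    using that by (simp add: AS_component component_eq image_image assemble_monomial)
  show "assemble (embed AS b) = embed A b" if "b \<in> carrier B" for b
    using that by (simp add: AS_embed assemble_monomial sec_one)
qed

end

section \<open>Equivalence of crossed products and of homomorphisms\<close>

text \<open>\<open>inv_into\<close> inverts \<open>\<phi>\<close> only on \<open>carrier A\<close>;
  the hypothesis that \<open>A\<close> is a crossed product places its components and the image of
  \<open>embed A\<close> there.\<close>

lemma equivalent_sym:
  assumes cp: "crossed_product G B A" and eq: "equivalent G B A A'"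
  shows "equivalent G B A' A"
proof -
  interpret crossed_product G B A by (rule cp)
  obtain \<phi> where \<phi>: "\<phi> \<in> alg_hom A A'" and bij: "bij_betw \<phi> (carrier A) (carrier A')"
    and comp: "\<And>g. g \<in> carrier G \<Longrightarrow> \<phi> ` component A g = component A' g"
    and emb: "\<And>b. b \<in> carrier B \<Longrightarrow> \<phi> (embed A b) = embed A' b"
    using eq by (auto simp: equivalent_def alg_iso_def)
  let ?\<psi> = "inv_into (carrier A) \<phi>"
  have left: "?\<psi> (\<phi> x) = x" if "x \<in> carrier A" for x
    using bij that by (simp add: bij_betw_def)
  show ?thesis
    unfolding equivalent_def
  proof (intro bexI[of _ ?\<psi>] conjI ballI)
    have "\<phi> \<in> ring_iso A A'"
      using \<phi> bij by (simp add: ring_iso_def alg_hom_def)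
    then have "?\<psi> \<in> ring_iso A' A"
      by (rule ring_iso_set_sym[OF A.ring_axioms])
    moreover have "?\<psi> (c \<odot>\<^bsub>A'\<^esub> y) = c \<odot>\<^bsub>A\<^esub> ?\<psi> y" if y: "y \<in> carrier A'" for c y
    proof -
      obtain x where "x \<in> carrier A" "y = \<phi> x"
        using bij y by (auto simp: bij_betw_def)
      then show ?thesis
        using left[OF A.scalar_closed, of x c] left[of x] alg_hom_smult[OF \<phi>, of x c] by simp
    qed
    ultimately show "?\<psi> \<in> alg_iso A' A"
      by (auto simp: alg_iso_def alg_hom_def ring_iso_def)
    show "?\<psi> ` component A' g = component A g" if g: "g \<in> carrier G" for g
    proof -
      have "?\<psi> ` \<phi> ` component A g = (\<lambda>x. x) ` component A g"
        unfolding image_image by (rule image_cong) (use left component_closed[OF g] in auto)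
      then show ?thesis by (simp add: comp[OF g])
    qed
    show "?\<psi> (embed A' b) = embed A b" if "b \<in> carrier B" for b
      using left[of "embed A b"] emb that by simp
  qed
qed

lemma equivalent_trans:
  assumes "equivalent G B A A'" "equivalent G B A' A''"
  shows "equivalent G B A A''"
proof -
  obtain \<phi> where \<phi>: "\<phi> \<in> alg_iso A A'"
    and \<phi>': "(\<forall>g\<in>carrier G. \<phi> ` component A g = component A' g) \<and>
      (\<forall>b\<in>carrier B. \<phi> (embed A b) = embed A' b)"
    using assms(1) unfolding equivalent_def ..
  obtain \<psi> where \<psi>: "\<psi> \<in> alg_iso A' A''"
    and \<psi>': "(\<forall>g\<in>carrier G. \<psi> ` component A' g = component A'' g) \<and>
      (\<forall>b\<in>carrier B. \<psi> (embed A' b) = embed A'' b)"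
    using assms(2) unfolding equivalent_def ..
  have "\<psi> \<circ> \<phi> \<in> alg_iso A A''"
  proof -
    have "\<psi> \<circ> \<phi> \<in> ring_hom A A''"
      by (rule ring_hom_trans[of _ _ A']) (use \<phi> \<psi> in \<open>simp_all add: alg_iso_def alg_hom_def\<close>)
    moreover have "bij_betw (\<psi> \<circ> \<phi>) (carrier A) (carrier A'')"
      by (rule bij_betw_trans[of _ _ "carrier A'"]) (use \<phi> \<psi> in \<open>simp_all add: alg_iso_def\<close>)
    moreover have "(\<psi> \<circ> \<phi>) (c \<odot>\<^bsub>A\<^esub> x) = c \<odot>\<^bsub>A''\<^esub> (\<psi> \<circ> \<phi>) x" if "x \<in> carrier A" for c x
      using \<phi> \<psi> that alg_hom_smult[of \<phi> A A' x c] alg_hom_smult[of \<psi> A' A'' "\<phi> x" c]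
      by (simp add: alg_iso_def ring_hom_closed[OF alg_hom_ring_hom, of \<phi> A A'])
    ultimately show ?thesis
      by (simp add: alg_iso_def alg_hom_def)
  qed
  moreover have "(\<psi> \<circ> \<phi>) ` component A g = component A'' g" if "g \<in> carrier G" for g
    using \<phi>' \<psi>' that image_comp[of \<psi> \<phi> "component A g"] by simp
  ultimately show ?thesis
    unfolding equivalent_def using \<phi>' \<psi>' by (intro bexI[of _ "\<psi> \<circ> \<phi>"]) simp_all
qed

lemma equivalent_refl: "equivalent G B A A"
  unfolding equivalent_def
  by (rule bexI[of _ "\<lambda>x. x"]) (auto simp: alg_iso_def alg_hom_def ring_hom_def bij_betw_def)

section \<open>Units, central units and conjugation\<close>

lemma (in monoid) Units_cancel:
  assumes "u \<in> Units G" "b \<in> carrier G"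
  shows "u \<otimes> (inv u \<otimes> b) = b" "inv u \<otimes> (u \<otimes> b) = b"
  using assms by (simp_all add: Units_closed flip: m_assoc)

text \<open>\<open>center_units\<close> takes its inverses inside the submonoid
  \<open>center\<close>. Such an inverse is also a two-sided inverse in the ambient monoid, and
  uniqueness of inverses identifies the two.\<close>

lemma (in monoid) center_units_closed:
  assumes "z \<in> carrier (center_units G)"
  shows "z \<in> Units G" "z \<in> center G" "inv z \<in> center G" "inv\<^bsub>center_units G\<^esub> z = inv z"
proof -
  let ?C = "G\<lparr>carrier := center G\<rparr>"
  have closed: "x \<in> carrier G" if "x \<in> center G" for x
    using that by (simp add: center_def)
  have mult: "x \<otimes> y \<in> center G" if x: "x \<in> center G" and y: "y \<in> center G" for x y
  proof -
    have "x \<otimes> y \<otimes> b = b \<otimes> (x \<otimes> y)" if b: "b \<in> carrier G" for b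
    proof -
      have "x \<otimes> b = b \<otimes> x" "y \<otimes> b = b \<otimes> y"
        using x y b by (simp_all add: center_def)
      then show ?thesis
        using closed[OF x] closed[OF y] b by (metis m_assoc)
    qed
    then show ?thesis using closed[OF x] closed[OF y] by (simp add: center_def)
  qed
  have one: "\<one> \<in> center G" by (simp add: center_def)
  interpret C: monoid ?C
    by (rule monoidI) (simp_all add: mult one closed m_assoc)
  have z: "z \<in> Units ?C"
    using assms by (simp add: center_units_def units_of_carrier)
  have "inv\<^bsub>?C\<^esub> z \<in> center G" "z \<otimes> inv\<^bsub>?C\<^esub> z = \<one>" "inv\<^bsub>?C\<^esub> z \<otimes> z = \<one>"
    using C.Units_inv_closed[OF z] C.Units_r_inv[OF z] C.Units_l_inv[OF z] by auto
  moreover show "z \<in> center G" using C.Units_closed[OF z] by simp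
  ultimately have "z \<in> carrier G" "inv\<^bsub>?C\<^esub> z \<in> carrier G"
    "z \<otimes> inv\<^bsub>?C\<^esub> z = \<one>" "inv\<^bsub>?C\<^esub> z \<otimes> z = \<one>"
    by (simp_all add: closed)
  then have inv: "inv z = inv\<^bsub>?C\<^esub> z" and "z \<in> Units G"
    by (rule inv_char, unfold Units_def, blast)
  then show "z \<in> Units G" "inv z \<in> center G"
    using C.Units_inv_closed[OF z] by simp_all
  show "inv\<^bsub>center_units G\<^esub> z = inv z"
    using C.units_of_inv[OF z] inv by (simp add: center_units_def)
qed

lemma mult_center_units: "x \<otimes>\<^bsub>center_units B\<^esub> y = x \<otimes>\<^bsub>B\<^esub> y"
  by (simp add: center_units_def units_of_mult)

lemma (in monoid) one_center_units: "\<one> \<in> carrier (center_units G)"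
  by (auto simp: center_units_def units_of_carrier Units_def center_def)

text \<open>Conjugation by \<open>inv u\<close> is the inverse map. Membership in \<open>Bij\<close>
  is what \<open>mult_alg_Aut\<close> requires to compute a product in \<open>alg_Aut B\<close> as a
  composition.\<close>

lemma (in monoid) conj_action_Bij:
  assumes u: "u \<in> Units G"
  shows "conj_action G u \<in> Bij (carrier G)"
proof -
  note [simp] = u Units_closed[OF u]
  have "bij_betw (conj_action G u) (carrier G) (carrier G)"
    by (rule bij_betwI[where g = "conj_action G (inv u)"])
      (auto simp: conj_action_def m_assoc Units_cancel)
  then show ?thesis by (simp add: Bij_def conj_action_def)
qed

text \<open>Turns equality of two coboundaries into a cocycle identity. In the application
  \<open>a\<close>, \<open>s\<close>, \<open>u\<close> are the values of a noncommutative cochain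
  and \<open>p\<close>, \<open>q\<close>, \<open>r\<close> the corresponding central ones; dividing
  the former by the latter gives the cocycle.\<close>

lemma (in monoid) cancel_central_units:
  assumes [simp]: "a \<in> carrier G" "s \<in> carrier G" "u \<in> Units G"
      "p \<in> Units G" "q \<in> Units G" "r \<in> Units G"
    and c: "p \<in> center G" "q \<in> center G" "r \<in> center G"
      "inv p \<in> center G"
    and eq: "a \<otimes> s \<otimes> inv u = p \<otimes> q \<otimes> inv r"
  shows "u \<otimes> inv r = (a \<otimes> inv p) \<otimes> (s \<otimes> inv q)"
proof -
  have [simp]: "u \<in> carrier G" "p \<in> carrier G" "q \<in> carrier G" "r \<in> carrier G"
    by (simp_all add: Units_closed)
  have comm: "x \<otimes> b = b \<otimes> x" if "x \<in> center G" "b \<in> carrier G" for x b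
    using that by (simp add: center_def)
  have cancel: "x \<otimes> v \<otimes> inv v = x" "x \<otimes> inv v \<otimes> v = x"
    if "v \<in> Units G" "x \<in> carrier G" for v x
    using that by (simp_all add: m_assoc Units_closed)
  have "a \<otimes> s = p \<otimes> q \<otimes> inv r \<otimes> u"
    using cancel(2)[of u "a \<otimes> s"] eq by simp
  also have "\<dots> = p \<otimes> (q \<otimes> (inv r \<otimes> u))"
    by (simp add: m_assoc)
  \<comment> \<open>The central factors go to the right in the order \<open>q\<close>,
    \<open>p\<close>, so that multiplying by \<open>inv p\<close> and then \<open>inv q\<close>
    removes them from the right.\<close>
  also have "\<dots> = inv r \<otimes> u \<otimes> q \<otimes> p"
    using comm[OF c(1), of "q \<otimes> (inv r \<otimes> u)"] comm[OF c(2), of "inv r \<otimes> u"]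
    by simp
  also have "inv r \<otimes> u = u \<otimes> inv r"
  proof -
    have "inv r \<otimes> u = inv r \<otimes> (u \<otimes> r) \<otimes> inv r"
      by (simp add: m_assoc)
    also have "u \<otimes> r = r \<otimes> u"
      using comm[OF c(3), of u] by simp
    also have "inv r \<otimes> (r \<otimes> u) \<otimes> inv r = u \<otimes> inv r"
      by (simp flip: m_assoc)
    finally show ?thesis .
  qed
  finally have as: "a \<otimes> s = u \<otimes> inv r \<otimes> q \<otimes> p" .
  have "(a \<otimes> inv p) \<otimes> (s \<otimes> inv q)
    = a \<otimes> (inv p \<otimes> s) \<otimes> inv q"
    by (simp add: m_assoc)
  also have "\<dots> = a \<otimes> s \<otimes> inv p \<otimes> inv q"
    using comm[OF c(4), of s] by (simp add: m_assoc)
  also have "\<dots> = u \<otimes> inv r"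
    unfolding as by (simp add: cancel)
  finally show ?thesis ..
qed

section \<open>Intertwining cocycles and equivalence of actions\<close>

context algebra_action
begin

text \<open>\<open>S g\<close> is onto: every \<open>b\<close> is the image of \<open>?c\<close>,
  and \<open>z\<close> commutes with \<open>?c\<close>.\<close>

lemma S_center:
  assumes g: "g \<in> carrier G" and z: "z \<in> center B"
  shows "S g z \<in> center B"
proof -
  have "S g z \<otimes>\<^bsub>B\<^esub> b = b \<otimes>\<^bsub>B\<^esub> S g z" if b: "b \<in> carrier B" for b
  proof -
    let ?c = "S (inv\<^bsub>G\<^esub> g) b"
    have "S g ?c = b" using S_comp[of g "inv\<^bsub>G\<^esub> g" b] g b by simp
    moreover have "S g (z \<otimes>\<^bsub>B\<^esub> ?c) = S g (?c \<otimes>\<^bsub>B\<^esub> z)"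
      using z g b by (simp add: center_def)
    moreover have "z \<in> carrier B" using z by (simp add: center_def)
    ultimately show ?thesis
      using g b by (simp add: S_mult)
  qed
  then show ?thesis using g z by (simp add: center_def)
qed

lemma S_Units:
  assumes g: "g \<in> carrier G" and u: "u \<in> Units B"
  shows "S g u \<in> Units B" "inv\<^bsub>B\<^esub> (S g u) = S g (inv\<^bsub>B\<^esub> u)"
proof -
  have "S g u \<otimes>\<^bsub>B\<^esub> S g (inv\<^bsub>B\<^esub> u) = \<one>\<^bsub>B\<^esub>" "S g (inv\<^bsub>B\<^esub> u) \<otimes>\<^bsub>B\<^esub> S g u = \<one>\<^bsub>B\<^esub>"
    using g u B.Units_closed[OF u] by (simp_all flip: S_mult)
  moreover have "S g u \<in> carrier B" "S g (inv\<^bsub>B\<^esub> u) \<in> carrier B"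
    using g u B.Units_closed[OF u] by simp_all
  ultimately show "S g u \<in> Units B" "inv\<^bsub>B\<^esub> (S g u) = S g (inv\<^bsub>B\<^esub> u)"
    by (auto simp: Units_def intro!: B.inv_char)
qed

text \<open>The last clause is the nonabelian 1-cocycle (crossed homomorphism) condition for
  \<open>S\<close> acting on the units of \<open>B\<close>; the middle one says that twisting
  \<open>S\<close> by the cocycle gives \<open>S'\<close>.\<close>

definition intertwining_cocycle :: "('g \<Rightarrow> 'b \<Rightarrow> 'b) \<Rightarrow> ('g \<Rightarrow> 'b) \<Rightarrow> bool"
  where "intertwining_cocycle S' h \<longleftrightarrow>
    (\<forall>g\<in>carrier G. h g \<in> Units B) \<and>
    (\<forall>g\<in>carrier G. \<forall>b\<in>carrier B. S' g b = h g \<otimes>\<^bsub>B\<^esub> S g b \<otimes>\<^bsub>B\<^esub> inv\<^bsub>B\<^esub> h g) \<and>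
    (\<forall>x\<in>carrier G. \<forall>y\<in>carrier G. h (x \<otimes>\<^bsub>G\<^esub> y) = h x \<otimes>\<^bsub>B\<^esub> S x (h y))"

text \<open>The cocycle identity at the identity element reads \<open>u = u u\<close> for a unit
  \<open>u\<close>. Hence cocycles satisfy the normalisation demanded by \<open>C1\<close>.\<close>

lemma cocycle_one:
  assumes "intertwining_cocycle S' h"
  shows "h \<one>\<^bsub>G\<^esub> = \<one>\<^bsub>B\<^esub>"
proof -
  have u: "h \<one>\<^bsub>G\<^esub> \<in> Units B" using assms by (simp add: intertwining_cocycle_def)
  have "h (\<one>\<^bsub>G\<^esub> \<otimes>\<^bsub>G\<^esub> \<one>\<^bsub>G\<^esub>) = h \<one>\<^bsub>G\<^esub> \<otimes>\<^bsub>B\<^esub> S \<one>\<^bsub>G\<^esub> (h \<one>\<^bsub>G\<^esub>)"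
    using assms unfolding intertwining_cocycle_def by blast
  then have "h \<one>\<^bsub>G\<^esub> \<otimes>\<^bsub>B\<^esub> \<one>\<^bsub>B\<^esub> = h \<one>\<^bsub>G\<^esub> \<otimes>\<^bsub>B\<^esub> h \<one>\<^bsub>G\<^esub>"
    using B.Units_closed[OF u] by simp
  then show ?thesis using u B.Units_closed[OF u] B.Units_l_cancel[of "h \<one>\<^bsub>G\<^esub>" "\<one>\<^bsub>B\<^esub>"] by simp
qed

text \<open>Products in \<open>alg_Aut B\<close> are extensional, so an equation of maps there is
  the same as the pointwise equation on \<open>carrier B\<close>.\<close>

lemma eq_conj_action_iff:
  assumes g: "g \<in> carrier G" and u: "u \<in> Units B" and f: "f \<in> extensional (carrier B)"
  shows "f = conj_action B u \<otimes>\<^bsub>alg_Aut B\<^esub> S g \<longleftrightarrow>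
    (\<forall>b\<in>carrier B. f b = u \<otimes>\<^bsub>B\<^esub> S g b \<otimes>\<^bsub>B\<^esub> inv\<^bsub>B\<^esub> u)"
proof -
  have "conj_action B u \<otimes>\<^bsub>alg_Aut B\<^esub> S g
    = (\<lambda>b\<in>carrier B. u \<otimes>\<^bsub>B\<^esub> S g b \<otimes>\<^bsub>B\<^esub> inv\<^bsub>B\<^esub> u)"
    unfolding mult_alg_Aut[OF B.conj_action_Bij[OF u] S_Bij[OF g]]
    using g by (auto simp: compose_def conj_action_def)
  moreover have "f = restrict k (carrier B) \<longleftrightarrow> (\<forall>b\<in>carrier B. f b = k b)" for k
    using f by (metis extensional_restrict restrict_apply' restrict_ext)
  ultimately show ?thesis by simp
qed

lemma trivial_coboundary:
  "(\<lambda>_\<in>carrier G \<times> carrier G. \<one>\<^bsub>B\<^esub>) \<in> coboundaries2 G (center_units B) S"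
  unfolding coboundaries2_def
proof (rule image_eqI)
  show "(\<lambda>_\<in>carrier G \<times> carrier G. \<one>\<^bsub>B\<^esub>)
    = coboundary G (center_units B) S (\<lambda>_\<in>carrier G. \<one>\<^bsub>B\<^esub>)"
    by (auto simp: coboundary_def B.center_units_closed(4)[OF B.one_center_units]
        mult_center_units intro!: restrict_ext)
qed (auto simp: B.one_center_units)

text \<open>Makes the cohomology class an explicit set of functions. As the identity of
  \<open>H2\<close> is the set of coboundaries by definition, vanishing becomes an equality of sets,
  with no group structure on cocycles to establish.\<close>

lemma coset_coboundaries:
  "H2_class G (center_units B) S c
    = (\<lambda>d. \<lambda>p\<in>carrier G \<times> carrier G. d p \<otimes>\<^bsub>B\<^esub> c p) ` coboundaries2 G (center_units B) S"
  by (auto simp: H2_class_def r_coset_def cocycles2_def mult_center_units)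

text \<open>A vanishing class provides a central cochain with the same coboundary as
  \<open>h\<close>, and the quotient is a cocycle. Conversely the coboundary of a cocycle is
  constantly one.\<close>

lemma hom_equiv_iff_cocycle:
  assumes S': "S' \<in> hom_gr G (alg_Aut B)"
  shows "(S, S') \<in> hom_equiv G B \<longleftrightarrow> (\<exists>h. intertwining_cocycle S' h)"
proof
  have S'_ext: "S' g \<in> extensional (carrier B)" if "g \<in> carrier G" for g
    using S' that by (auto simp: hom_gr_def hom_def carrier_alg_Aut Bij_def)
  {
    assume "(S, S') \<in> hom_equiv G B"
    then obtain h where h: "h \<in> C1 G B"
      and conj: "\<And>g. g \<in> carrier G \<Longrightarrow> S' g = conj_action B (h g) \<otimes>\<^bsub>alg_Aut B\<^esub> S g"
      and triv: "H2_class G (center_units B) S (coboundary G (units_of B) S h)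
        = \<one>\<^bsub>H2 G (center_units B) S\<^esub>"
      by (auto simp: hom_equiv_def)
    have hU: "h g \<in> Units B" if "g \<in> carrier G" for g
      using h that by (auto simp: C1_def)
    note [simp] = hU B.Units_closed[OF hU]
    have hS: "S' g b = h g \<otimes>\<^bsub>B\<^esub> S g b \<otimes>\<^bsub>B\<^esub> inv\<^bsub>B\<^esub> h g"
      if "g \<in> carrier G" "b \<in> carrier B" for g b
      using conj eq_conj_action_iff[OF that(1) hU S'_ext] that by blast
    let ?d = "coboundary G (units_of B) S h"
    have d: "?d (x, y) = h x \<otimes>\<^bsub>B\<^esub> S x (h y) \<otimes>\<^bsub>B\<^esub> inv\<^bsub>B\<^esub> h (x \<otimes>\<^bsub>G\<^esub> y)"
      if "x \<in> carrier G" "y \<in> carrier G" for x y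
      using that by (simp add: coboundary_def units_of_mult B.units_of_inv)
    have d_ext: "?d \<in> extensional (carrier G \<times> carrier G)"
      by (simp add: coboundary_def)
    \<comment> \<open>The trivial coboundary times \<open>?d\<close> lies in the coset of
      \<open>?d\<close>, which by \<open>triv\<close> is the set of coboundaries itself. So
      \<open>?d\<close> is the coboundary of some central \<open>z\<close>.\<close>
    have "(\<lambda>p\<in>carrier G \<times> carrier G. (\<lambda>_\<in>carrier G \<times> carrier G. \<one>\<^bsub>B\<^esub>) p \<otimes>\<^bsub>B\<^esub> ?d p)
        \<in> coboundaries2 G (center_units B) S"
      using triv imageI[OF trivial_coboundary,
          of "\<lambda>d. \<lambda>p\<in>carrier G \<times> carrier G. d p \<otimes>\<^bsub>B\<^esub> ?d p"]
      unfolding coset_coboundaries H2_def by (simp only: one_FactGroup)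
    moreover have "(\<lambda>p\<in>carrier G \<times> carrier G. (\<lambda>_\<in>carrier G \<times> carrier G. \<one>\<^bsub>B\<^esub>) p \<otimes>\<^bsub>B\<^esub> ?d p) = ?d"
      by (rule extensionalityI[of _ "carrier G \<times> carrier G"]) (auto simp: d d_ext)
    ultimately obtain z where z: "z \<in> carrier G \<rightarrow>\<^sub>E carrier (center_units B)"
      and dz: "?d = coboundary G (center_units B) S z"
      by (auto simp: coboundaries2_def)
    have zc: "z g \<in> carrier (center_units B)" if "g \<in> carrier G" for g
      using z that by auto
    note zU = B.center_units_closed[OF zc]
    note [simp] = zU(1) B.Units_closed[OF zU(1)]
    \<comment> \<open>Dividing by the central \<open>z\<close> leaves conjugation unchanged and
      cancels the coboundary.\<close>
    have "intertwining_cocycle S' (\<lambda>g. h g \<otimes>\<^bsub>B\<^esub> inv\<^bsub>B\<^esub> z g)"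
      unfolding intertwining_cocycle_def
    proof (intro conjI ballI)
      fix g assume g: "g \<in> carrier G"
      then show "h g \<otimes>\<^bsub>B\<^esub> inv\<^bsub>B\<^esub> z g \<in> Units B" by simp
      have inv: "inv\<^bsub>B\<^esub> (h g \<otimes>\<^bsub>B\<^esub> inv\<^bsub>B\<^esub> z g) = z g \<otimes>\<^bsub>B\<^esub> inv\<^bsub>B\<^esub> h g"
        by (rule B.inv_char) (use g in \<open>simp_all add: B.m_assoc B.Units_cancel\<close>)
      fix b assume b: "b \<in> carrier B"
      have "h g \<otimes>\<^bsub>B\<^esub> inv\<^bsub>B\<^esub> z g \<otimes>\<^bsub>B\<^esub> S g b \<otimes>\<^bsub>B\<^esub> (z g \<otimes>\<^bsub>B\<^esub> inv\<^bsub>B\<^esub> h g)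
        = h g \<otimes>\<^bsub>B\<^esub> (inv\<^bsub>B\<^esub> z g \<otimes>\<^bsub>B\<^esub> (S g b \<otimes>\<^bsub>B\<^esub> z g)) \<otimes>\<^bsub>B\<^esub> inv\<^bsub>B\<^esub> h g"
        using g b by (simp add: B.m_assoc)
      also have "S g b \<otimes>\<^bsub>B\<^esub> z g = z g \<otimes>\<^bsub>B\<^esub> S g b"
        using zU(2)[OF g] g b by (simp add: center_def)
      also have "inv\<^bsub>B\<^esub> z g \<otimes>\<^bsub>B\<^esub> (z g \<otimes>\<^bsub>B\<^esub> S g b) = S g b"
        using g b by (simp flip: B.m_assoc)
      finally show "S' g b = h g \<otimes>\<^bsub>B\<^esub> inv\<^bsub>B\<^esub> z g \<otimes>\<^bsub>B\<^esub> S g b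
          \<otimes>\<^bsub>B\<^esub> inv\<^bsub>B\<^esub> (h g \<otimes>\<^bsub>B\<^esub> inv\<^bsub>B\<^esub> z g)"
        using hS g b inv by simp
    next
      fix x y assume x: "x \<in> carrier G" and y: "y \<in> carrier G"
      have "h (x \<otimes>\<^bsub>G\<^esub> y) \<otimes>\<^bsub>B\<^esub> inv\<^bsub>B\<^esub> z (x \<otimes>\<^bsub>G\<^esub> y)
        = h x \<otimes>\<^bsub>B\<^esub> inv\<^bsub>B\<^esub> z x \<otimes>\<^bsub>B\<^esub> (S x (h y) \<otimes>\<^bsub>B\<^esub> inv\<^bsub>B\<^esub> S x (z y))"
      proof (rule B.cancel_central_units)
        show "S x (z y) \<in> Units B" "S x (z y) \<in> center B"
          by (rule S_Units(1)[OF x zU(1)[OF y]], rule S_center[OF x zU(2)[OF y]])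
        show "h x \<otimes>\<^bsub>B\<^esub> S x (h y) \<otimes>\<^bsub>B\<^esub> inv\<^bsub>B\<^esub> h (x \<otimes>\<^bsub>G\<^esub> y)
          = z x \<otimes>\<^bsub>B\<^esub> S x (z y) \<otimes>\<^bsub>B\<^esub> inv\<^bsub>B\<^esub> z (x \<otimes>\<^bsub>G\<^esub> y)"
          using d[OF x y] fun_cong[OF dz, of "(x, y)"] x y
          by (simp add: coboundary_def zU(4) mult_center_units)
      qed (simp_all add: x y zU(2,3))
      then show "h (x \<otimes>\<^bsub>G\<^esub> y) \<otimes>\<^bsub>B\<^esub> inv\<^bsub>B\<^esub> z (x \<otimes>\<^bsub>G\<^esub> y)
        = h x \<otimes>\<^bsub>B\<^esub> inv\<^bsub>B\<^esub> z x \<otimes>\<^bsub>B\<^esub> S x (h y \<otimes>\<^bsub>B\<^esub> inv\<^bsub>B\<^esub> z y)"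
        using x y by (simp add: S_mult S_Units)
    qed
    then show "\<exists>h. intertwining_cocycle S' h" by blast
  next
    assume "\<exists>h. intertwining_cocycle S' h"
    then obtain h where h: "intertwining_cocycle S' h" ..
    note hD = h[unfolded intertwining_cocycle_def]
    \<comment> \<open>\<open>C1\<close> consists of extensional maps, whereas a cocycle is
      constrained only on \<open>carrier G\<close>.\<close>
    let ?h = "restrict h (carrier G)"
    have hU: "h g \<in> Units B" if "g \<in> carrier G" for g
      using hD that by blast
    have "?h \<in> C1 G B"
      using hU cocycle_one[OF h] by (auto simp: C1_def)
    moreover have "S' g = conj_action B (?h g) \<otimes>\<^bsub>alg_Aut B\<^esub> S g" if "g \<in> carrier G" for g
      using eq_conj_action_iff[OF that hU[OF that] S'_ext[OF that]] hD that by simp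
    moreover have "coboundary G (units_of B) S ?h = (\<lambda>_\<in>carrier G \<times> carrier G. \<one>\<^bsub>B\<^esub>)"
      unfolding coboundary_def
    proof (intro restrict_ext, clarify)
      fix x y assume x: "x \<in> carrier G" and y: "y \<in> carrier G"
      have "h x \<otimes>\<^bsub>B\<^esub> S x (h y) = h (x \<otimes>\<^bsub>G\<^esub> y)" using hD x y by simp
      then show "?h x \<otimes>\<^bsub>units_of B\<^esub> S x (?h y) \<otimes>\<^bsub>units_of B\<^esub>
          inv\<^bsub>units_of B\<^esub> ?h (x \<otimes>\<^bsub>G\<^esub> y) = \<one>\<^bsub>B\<^esub>"
        using x y hU by (simp add: units_of_mult B.units_of_inv)
    qed
    moreover have "H2_class G (center_units B) S (\<lambda>_\<in>carrier G \<times> carrier G. \<one>\<^bsub>B\<^esub>)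
      = \<one>\<^bsub>H2 G (center_units B) S\<^esub>"
    proof -
      \<comment> \<open>The coset of the constant one is the set of coboundaries, because
        multiplying by it fixes each coboundary; this uses that coboundaries are extensional with
        values in \<open>carrier B\<close>.\<close>
      have "(\<lambda>p\<in>carrier G \<times> carrier G. d p \<otimes>\<^bsub>B\<^esub> (\<lambda>_\<in>carrier G \<times> carrier G. \<one>\<^bsub>B\<^esub>) p) = d"
        if d2: "d \<in> coboundaries2 G (center_units B) S" for d
      proof -
        obtain z where z: "z \<in> carrier G \<rightarrow>\<^sub>E carrier (center_units B)"
          and d: "d = coboundary G (center_units B) S z"
          using d2 by (auto simp: coboundaries2_def)
        have zc: "z g \<in> carrier (center_units B)" if "g \<in> carrier G" for g
          using z that by auto
        note zU = B.center_units_closed[OF zc]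
        have "d (x, y) \<in> carrier B" if "x \<in> carrier G" "y \<in> carrier G" for x y
          using that zU(1) B.Units_closed[OF zU(1)]
          by (simp add: d coboundary_def zU(4) mult_center_units)
        moreover have "d \<in> extensional (carrier G \<times> carrier G)"
          by (simp add: d coboundary_def)
        ultimately show ?thesis
          by (intro extensionalityI[of _ "carrier G \<times> carrier G"]) auto
      qed
      then show ?thesis
        unfolding coset_coboundaries H2_def by simp
    qed
    ultimately have "\<exists>h\<in>C1 G B. (\<forall>g\<in>carrier G. S' g = conj_action B (h g) \<otimes>\<^bsub>alg_Aut B\<^esub> S g) \<and>
        H2_class G (center_units B) S (coboundary G (units_of B) S h) = \<one>\<^bsub>H2 G (center_units B) S\<^esub>"
      by (intro bexI[of _ ?h] conjI ballI) simp_all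
    then show "(S, S') \<in> hom_equiv G B"
      using S' S_hom_gr by (simp only: hom_equiv_def mem_Collect_eq case_prod_conv simp_thms)
  }
qed

text \<open>The monomials with coefficient \<open>h g\<close> in degree \<open>g\<close> form a
  section of \<open>AS\<close> that is covariant for \<open>S'\<close>, not for \<open>S\<close>.
  The comparison map therefore starts at the twisted algebra of \<open>S'\<close>.\<close>

lemma equivalent_of_cocycle:
  assumes S': "S' \<in> hom_gr G (alg_Aut B)" and h: "intertwining_cocycle S' h"
  shows "equivalent G B (twisted_algebra G B S') AS"
proof -
  note hD = h[unfolded intertwining_cocycle_def]
  have hU: "h g \<in> Units B" if "g \<in> carrier G" for g
    using hD that by simp
  note [simp] = hU B.Units_closed[OF hU]
  interpret A: crossed_product G B AS by (rule AS_crossed_product)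
  interpret S': algebra_action G B S'
    by unfold_locales (fact finite_group S')+
  interpret covariant_section G B AS S' "\<lambda>g. monomial G B (h g) g"
  proof
    fix g assume g: "g \<in> carrier G"
    show "monomial G B (h g) g \<in> component AS g"
      using g by (auto simp: AS_component)
    show "monomial G B (h (g \<otimes>\<^bsub>G\<^esub> k)) (g \<otimes>\<^bsub>G\<^esub> k)
      = monomial G B (h g) g \<otimes>\<^bsub>AS\<^esub> monomial G B (h k) k" if k: "k \<in> carrier G" for k
      using g k hD by (simp add: monomial_mult)
    fix b assume b: "b \<in> carrier B"
    \<comment> \<open>The intertwining relation with the inverse cleared is exactly covariance on
      coefficients.\<close>
    have "S' g b \<otimes>\<^bsub>B\<^esub> h g = h g \<otimes>\<^bsub>B\<^esub> S g b"
      using g b hD by (simp add: B.m_assoc)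
    then show "monomial G B (h g) g \<otimes>\<^bsub>AS\<^esub> embed AS b
      = embed AS (S' g b) \<otimes>\<^bsub>AS\<^esub> monomial G B (h g) g"
      using g b by (simp add: AS_embed monomial_mult)
  qed (simp add: AS_one cocycle_one[OF h])
  show ?thesis by (rule equivalent_twisted_algebra)
qed

text \<open>An equivalence preserves degrees, so it sends the basis element at \<open>g\<close> to a
  monomial of degree \<open>g\<close>; its coefficient is \<open>h g\<close>. Multiplicativity on
  basis elements gives the cocycle identity.\<close>

lemma cocycle_of_equivalent:
  assumes S': "S' \<in> hom_gr G (alg_Aut B)" and eq: "equivalent G B (twisted_algebra G B S') AS"
  shows "\<exists>h. intertwining_cocycle S' h"
proof -
  interpret S': algebra_action G B S'
    by unfold_locales (fact finite_group S')+
  obtain \<phi> where \<phi>: "\<phi> \<in> ring_hom S'.AS AS"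
    and comp: "\<And>g. g \<in> carrier G \<Longrightarrow> \<phi> ` component S'.AS g = component AS g"
    and emb: "\<And>b. b \<in> carrier B \<Longrightarrow> \<phi> (monomial G B b \<one>\<^bsub>G\<^esub>) = monomial G B b \<one>\<^bsub>G\<^esub>"
    using eq by (auto simp: equivalent_def alg_iso_def alg_hom_def AS_embed S'.AS_embed)
  have "\<exists>b\<in>carrier B. \<phi> (monomial G B \<one>\<^bsub>B\<^esub> g) = monomial G B b g" if g: "g \<in> carrier G" for g
  proof -
    have "\<phi> (monomial G B \<one>\<^bsub>B\<^esub> g) \<in> component AS g"
      unfolding comp[OF g, symmetric] S'.AS_component by auto
    then show ?thesis by (auto simp: AS_component)
  qed
  then obtain h where [simp]: "\<And>g. g \<in> carrier G \<Longrightarrow> h g \<in> carrier B"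
    and \<phi>h: "\<And>g. g \<in> carrier G \<Longrightarrow> \<phi> (monomial G B \<one>\<^bsub>B\<^esub> g) = monomial G B (h g) g"
    by metis
  have \<phi>_mult: "\<phi> (monomial G B (b \<otimes>\<^bsub>B\<^esub> S' g c) (g \<otimes>\<^bsub>G\<^esub> k))
      = \<phi> (monomial G B b g) \<otimes>\<^bsub>AS\<^esub> \<phi> (monomial G B c k)"
    if "g \<in> carrier G" "k \<in> carrier G" "b \<in> carrier B" "c \<in> carrier B" for g k b c
    using ring_hom_mult[OF \<phi> S'.monomial_AS S'.monomial_AS, of b c g k] that
    by (simp add: S'.monomial_mult)
  have cocycle: "h (x \<otimes>\<^bsub>G\<^esub> y) = h x \<otimes>\<^bsub>B\<^esub> S x (h y)" if "x \<in> carrier G" "y \<in> carrier G" for x y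
    using \<phi>_mult[of x y "\<one>\<^bsub>B\<^esub>" "\<one>\<^bsub>B\<^esub>"] that by (simp add: \<phi>h monomial_mult monomial_eq_iff)
  have one: "h \<one>\<^bsub>G\<^esub> = \<one>\<^bsub>B\<^esub>"
    using \<phi>h[of "\<one>\<^bsub>G\<^esub>"] emb[of "\<one>\<^bsub>B\<^esub>"] by (simp add: monomial_eq_iff)
  have unit: "h g \<in> Units B" if g: "g \<in> carrier G" for g
  proof -
    let ?i = "inv\<^bsub>G\<^esub> g"
    have "h g \<otimes>\<^bsub>B\<^esub> S g (h ?i) = \<one>\<^bsub>B\<^esub>"
      using cocycle[of g ?i] one g by simp
    moreover have "S g (h ?i) \<otimes>\<^bsub>B\<^esub> h g = \<one>\<^bsub>B\<^esub>"
    proof -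
      \<comment> \<open>Applying \<open>S g\<close> to the cocycle identity at \<open>?i\<close> and
        \<open>g\<close> shows that the right inverse just found is also a left inverse.\<close>
      have "S g (h ?i \<otimes>\<^bsub>B\<^esub> S ?i (h g)) = \<one>\<^bsub>B\<^esub>"
        using cocycle[of ?i g, symmetric] one g by simp
      then show ?thesis
        using S_comp[of g ?i "h g"] g by (simp add: S_mult)
    qed
    ultimately show ?thesis
      using g unfolding Units_def by (auto intro!: bexI[of _ "S g (h ?i)"])
  qed
  have "S' g b = h g \<otimes>\<^bsub>B\<^esub> S g b \<otimes>\<^bsub>B\<^esub> inv\<^bsub>B\<^esub> h g" if g: "g \<in> carrier G" and b: "b \<in> carrier B" for g b
  proof -
    \<comment> \<open>The element with coefficient \<open>S' g b\<close> in degree \<open>g\<close>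
      factors as that coefficient times a basis element and as the basis element times
      \<open>b\<close>. Comparing the two images under \<open>\<phi>\<close> gives the intertwining
      relation.\<close>
    have "monomial G B (S' g b \<otimes>\<^bsub>B\<^esub> h g) g = \<phi> (monomial G B (S' g b) g)"
      using \<phi>_mult[of "\<one>\<^bsub>G\<^esub>" g "S' g b" "\<one>\<^bsub>B\<^esub>"] g b by (simp add: emb \<phi>h monomial_mult)
    also have "\<dots> = monomial G B (h g \<otimes>\<^bsub>B\<^esub> S g b) g"
      using \<phi>_mult[of g "\<one>\<^bsub>G\<^esub>" "\<one>\<^bsub>B\<^esub>" b] g b by (simp add: emb \<phi>h monomial_mult)
    finally have "h g \<otimes>\<^bsub>B\<^esub> S g b = S' g b \<otimes>\<^bsub>B\<^esub> h g"
      using g by (simp add: monomial_eq_iff)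
    then show ?thesis
      using g b unit by (simp add: B.m_assoc)
  qed
  then show ?thesis
    using unit cocycle unfolding intertwining_cocycle_def by blast
qed

text \<open>Transfers questions about \<open>hom_equiv\<close> to isomorphisms of algebras. The
  membership conjunct is present because \<open>hom_equiv\<close> contains only pairs of
  homomorphisms.\<close>

lemma hom_equiv_iff_equivalent:
  "(S, S') \<in> hom_equiv G B \<longleftrightarrow>
    S' \<in> hom_gr G (alg_Aut B) \<and> equivalent G B (twisted_algebra G B S') AS"
proof (cases "S' \<in> hom_gr G (alg_Aut B)")
  case True
  then show ?thesis
    using hom_equiv_iff_cocycle equivalent_of_cocycle cocycle_of_equivalent by blast
next
  case False
  then show ?thesis by (simp add: hom_equiv_def)
qed

end

text \<open>Conjugation by a splitting preserves degree one and so defines an action on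
  \<open>B\<close>, for which the splitting is covariant. The element type of \<open>A\<close> is
  arbitrary here.\<close>

lemma (in crossed_product) split_imp_equivalent_twisted_algebra:
  assumes fin: "finite (carrier G)" and split: "split_sequence G A"
  shows "\<exists>S\<in>hom_gr G (alg_Aut B). equivalent G B A (twisted_algebra G B S)"
proof -
  obtain \<sigma> where \<sigma>: "\<sigma> \<in> hom G (homogeneous_units G A)"
    and comp: "\<And>g. g \<in> carrier G \<Longrightarrow> \<sigma> g \<in> component A g"
    using split by (auto simp: split_sequence_def)
  have unit: "\<sigma> g \<in> Units A" if "g \<in> carrier G" for g
    using hom_in_carrier[OF \<sigma> that] by (auto simp: homogeneous_units_def)
  note [simp] = A.Units_closed[OF unit]
  have mult: "\<sigma> (g \<otimes>\<^bsub>G\<^esub> k) = \<sigma> g \<otimes>\<^bsub>A\<^esub> \<sigma> k" if "g \<in> carrier G" "k \<in> carrier G" for g k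
    using hom_mult[OF \<sigma> that] by (simp add: homogeneous_units_def units_of_mult)
  have one: "\<sigma> \<one>\<^bsub>G\<^esub> = \<one>\<^bsub>A\<^esub>"
    using mult[of "\<one>\<^bsub>G\<^esub>" "\<one>\<^bsub>G\<^esub>"] A.Units_l_cancel[OF unit, of "\<one>\<^bsub>G\<^esub>" "\<one>\<^bsub>A\<^esub>" "\<sigma> \<one>\<^bsub>G\<^esub>"] by simp
  let ?e = "embed A"
  \<comment> \<open>Conjugation takes place in \<open>A\<close>; \<open>inv_into\<close> pulls the
    result back along \<open>embed A\<close>.\<close>
  define S where "S = (\<lambda>g\<in>carrier G. \<lambda>b\<in>carrier B.
    inv_into (carrier B) ?e (\<sigma> g \<otimes>\<^bsub>A\<^esub> ?e b \<otimes>\<^bsub>A\<^esub> \<sigma> (inv\<^bsub>G\<^esub> g)))"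
  have S: "S g b \<in> carrier B" "?e (S g b) = \<sigma> g \<otimes>\<^bsub>A\<^esub> ?e b \<otimes>\<^bsub>A\<^esub> \<sigma> (inv\<^bsub>G\<^esub> g)"
    if g: "g \<in> carrier G" and b: "b \<in> carrier B" for g b
  proof -
    have "\<sigma> g \<otimes>\<^bsub>A\<^esub> ?e b \<otimes>\<^bsub>A\<^esub> \<sigma> (inv\<^bsub>G\<^esub> g) \<in> component A (g \<otimes>\<^bsub>G\<^esub> \<one>\<^bsub>G\<^esub> \<otimes>\<^bsub>G\<^esub> inv\<^bsub>G\<^esub> g)"
      using g b by (intro component_mult comp embed_component) auto
    then have "\<sigma> g \<otimes>\<^bsub>A\<^esub> ?e b \<otimes>\<^bsub>A\<^esub> \<sigma> (inv\<^bsub>G\<^esub> g) \<in> ?e ` carrier B"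
      using g embed_bij by (simp add: bij_betw_def)
    then show "S g b \<in> carrier B" "?e (S g b) = \<sigma> g \<otimes>\<^bsub>A\<^esub> ?e b \<otimes>\<^bsub>A\<^esub> \<sigma> (inv\<^bsub>G\<^esub> g)"
      using g b by (simp_all add: S_def inv_into_into f_inv_into_f)
  qed
  have cancel: "\<sigma> (inv\<^bsub>G\<^esub> g) \<otimes>\<^bsub>A\<^esub> (\<sigma> g \<otimes>\<^bsub>A\<^esub> a) = a" if "g \<in> carrier G" "a \<in> carrier A" for g a
    using mult[of "inv\<^bsub>G\<^esub> g" g, symmetric] one that by (simp flip: A.m_assoc)
  have S_hom: "S \<in> hom_gr G (alg_Aut B)"
  proof (rule hom_gr_alg_AutI)
    fix g assume g: "g \<in> carrier G"
    have "S g \<in> ring_hom B B"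
    proof (rule ring_hom_memI)
      fix a b assume a: "a \<in> carrier B" and b: "b \<in> carrier B"
      show "S g (a \<otimes>\<^bsub>B\<^esub> b) = S g a \<otimes>\<^bsub>B\<^esub> S g b"
        \<comment> \<open>Here and below, identities in \<open>B\<close> are checked in
          \<open>A\<close>, where \<open>S\<close> is literally conjugation, using injectivity of
          \<open>embed A\<close>.\<close>
        by (subst embed_eq_iff[symmetric])
          (use g a b in \<open>simp_all add: S embed_mult A.m_assoc cancel\<close>)
      show "S g (a \<oplus>\<^bsub>B\<^esub> b) = S g a \<oplus>\<^bsub>B\<^esub> S g b"
        by (subst embed_eq_iff[symmetric])
          (use g a b in \<open>simp_all add: S embed_add A.l_distr A.r_distr\<close>)
    next
      show "S g \<one>\<^bsub>B\<^esub> = \<one>\<^bsub>B\<^esub>"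
        by (subst embed_eq_iff[symmetric])
          (use g one in \<open>simp_all add: S flip: mult\<close>)
    qed (use g S in simp)
    moreover have "S g (c \<odot>\<^bsub>B\<^esub> b) = c \<odot>\<^bsub>B\<^esub> S g b" if b: "b \<in> carrier B" for c b
      by (subst embed_eq_iff[symmetric])
        (use g b in \<open>simp_all add: S alg_hom_smult[OF embed_hom] A.smult_mult_left
          A.smult_mult_right\<close>)
    ultimately show "S g \<in> alg_hom B B" by (simp add: alg_hom_def)
    show "S g \<in> extensional (carrier B)" using g by (simp add: S_def)
    fix k b assume k: "k \<in> carrier G" and b: "b \<in> carrier B"
    show "S (g \<otimes>\<^bsub>G\<^esub> k) b = S g (S k b)"
      by (subst embed_eq_iff[symmetric])
        (use g k b in \<open>simp_all add: S mult A.m_assoc G.inv_mult_group\<close>)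
  next
    show "S \<one>\<^bsub>G\<^esub> b = b" if "b \<in> carrier B" for b
      by (subst embed_eq_iff[symmetric]) (use that in \<open>simp_all add: S one\<close>)
  qed (simp_all add: S_def G.group_axioms)
  interpret algebra_action G B S
    by unfold_locales (fact fin S_hom)+
  interpret covariant_section G B A S \<sigma>
  proof
    fix g b assume g: "g \<in> carrier G" and b: "b \<in> carrier B"
    show "\<sigma> g \<otimes>\<^bsub>A\<^esub> ?e b = ?e (S g b) \<otimes>\<^bsub>A\<^esub> \<sigma> g"
      using g b cancel[of g "\<one>\<^bsub>A\<^esub>"] by (simp add: S A.m_assoc)
  qed (simp_all add: comp mult one)
  have "equivalent G B A AS"
    using AS_crossed_product equivalent_twisted_algebra by (rule equivalent_sym)
  then show ?thesis using S_hom by blast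
qed

section \<open>The classification map\<close>

text \<open>Reflexivity, symmetry and transitivity are inherited from \<open>equivalent\<close> for
  twisted algebras, without manipulating cochains.\<close>

lemma hom_equiv_equiv:
  assumes "complex_algebra B" "group G" "finite (carrier G)"
  shows "equiv (hom_gr G (alg_Aut B)) (hom_equiv G B)"
proof -
  have act: "algebra_action G B S" if "S \<in> hom_gr G (alg_Aut B)" for S
    using assms that by (simp add: algebra_action_def algebra_action_axioms_def)
  have dom: "S \<in> hom_gr G (alg_Aut B)" if "(S, S') \<in> hom_equiv G B" for S S'
    using that by (simp add: hom_equiv_def)
  note iff = algebra_action.hom_equiv_iff_equivalent[OF act]
  show ?thesis
  proof (rule equivI)
    show "hom_equiv G B \<subseteq> hom_gr G (alg_Aut B) \<times> hom_gr G (alg_Aut B)"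
      by (auto simp: hom_equiv_def)
    show "refl_on (hom_gr G (alg_Aut B)) (hom_equiv G B)"
      by (simp add: refl_on_def iff equivalent_refl)
    show "sym (hom_equiv G B)"
      using dom iff equivalent_sym[OF algebra_action.AS_crossed_product[OF act]]
      by (meson symI)
    show "trans (hom_equiv G B)"
      using dom iff equivalent_trans by (meson transI)
  qed
qed

text \<open>One direction makes \<open>Phi\<close> well defined, the other makes it
  injective.\<close>

lemma ext_class_eq_iff:
  fixes G :: "('g, 'm) monoid_scheme" and B :: "(complex, 'b, 'k) module_scheme"
  assumes "complex_algebra B" "group G" "finite (carrier G)"
    and S: "S \<in> hom_gr G (alg_Aut B)" and S': "S' \<in> hom_gr G (alg_Aut B)"
  shows "ext_class G B S = ext_class G B S' \<longleftrightarrow> (S, S') \<in> hom_equiv G B"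
proof -
  interpret S: algebra_action G B S
    using assms by (simp add: algebra_action_def algebra_action_axioms_def)
  interpret S': algebra_action G B S'
    using assms by (simp add: algebra_action_def algebra_action_axioms_def)
  note cp = S.AS_crossed_product S'.AS_crossed_product
  have "ext_class G B S = ext_class G B S' \<longleftrightarrow> equivalent G B S'.AS S.AS"
  proof
    assume "ext_class G B S = ext_class G B S'"
    moreover have "S.AS \<in> ext_class G B S"
      using cp by (simp add: ext_class_def ext_rel_def equivalent_refl)
    ultimately show "equivalent G B S'.AS S.AS"
      by (simp add: ext_class_def ext_rel_def)
  next
    assume eq: "equivalent G B S'.AS S.AS"
    have "equivalent G B S.AS A \<longleftrightarrow> equivalent G B S'.AS A" for A :: "('g, 'b, 'g \<Rightarrow> 'b) graded_algebra"
      using eq equivalent_sym[OF cp(2) eq] equivalent_trans by metis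
    then show "ext_class G B S = ext_class G B S'"
      using cp by (simp add: ext_class_def ext_rel_def)
  qed
  then show ?thesis
    using S.hom_equiv_iff_equivalent S' by simp
qed

text \<open>\<open>ext_class G B\<close> is constant on an equivalence class, so its image there is
  a singleton and \<open>the_elem\<close> returns the common value.\<close>

lemma Phi_class:
  assumes "complex_algebra B" "group G" "finite (carrier G)" and S: "S \<in> hom_gr G (alg_Aut B)"
  shows "Phi G B (hom_equiv G B `` {S}) = ext_class G B S"
proof -
  have "ext_class G B T = ext_class G B S" if "(S, T) \<in> hom_equiv G B" for T
    using ext_class_eq_iff[OF assms(1-3) S, of T] that by (simp add: hom_equiv_def)
  moreover have "S \<in> hom_equiv G B `` {S}"
    using equiv_class_self[OF hom_equiv_equiv[OF assms(1-3)] S] .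
  ultimately have "ext_class G B ` (hom_equiv G B `` {S}) = {ext_class G B S}"
    by blast
  then show ?thesis by (simp add: Phi_def)
qed

text \<open>Injectivity is \<open>ext_class_eq_iff\<close>; surjectivity replaces a split crossed
  product by the twisted algebra of its conjugation action.\<close>

lemma Phi_bij:
  fixes G :: "('g, 'm) monoid_scheme" and B :: "(complex, 'b, 'k) module_scheme"
  assumes "complex_algebra B" "group G" "finite (carrier G)"
  shows "bij_betw (Phi G B) (hom_gr G (alg_Aut B) // hom_equiv G B) (Ext_split G B)"
  unfolding bij_betw_def
proof (intro conjI subset_antisym image_subsetI subsetI)
  show "inj_on (Phi G B) (hom_gr G (alg_Aut B) // hom_equiv G B)"
  proof (rule inj_onI)
    fix c d assume "c \<in> hom_gr G (alg_Aut B) // hom_equiv G B" "d \<in> hom_gr G (alg_Aut B) // hom_equiv G B"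
      and eq: "Phi G B c = Phi G B d"
    then obtain S S' where S: "S \<in> hom_gr G (alg_Aut B)" "c = hom_equiv G B `` {S}"
      and S': "S' \<in> hom_gr G (alg_Aut B)" "d = hom_equiv G B `` {S'}"
      by (auto simp: quotient_def)
    with eq have "(S, S') \<in> hom_equiv G B"
      using Phi_class[OF assms] ext_class_eq_iff[OF assms] by simp
    then show "c = d"
      using S S' equiv_class_eq[OF hom_equiv_equiv[OF assms]] by simp
  qed
next
  fix c assume "c \<in> hom_gr G (alg_Aut B) // hom_equiv G B"
  then obtain S where S: "S \<in> hom_gr G (alg_Aut B)" "Phi G B c = ext_class G B S"
    using Phi_class[OF assms] by (auto simp: quotient_def)
  interpret S: algebra_action G B S
    using assms S by (simp add: algebra_action_def algebra_action_axioms_def)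
  show "Phi G B c \<in> Ext_split G B"
    unfolding Ext_split_def S(2) ext_class_def
    by (rule quotientI) (simp add: S.AS_crossed_product S.AS_split)
next
  fix E :: "('g, 'b, 'g \<Rightarrow> 'b) graded_algebra set"
  assume "E \<in> Ext_split G B"
  then obtain A where A: "crossed_product G B A" "split_sequence G A" "E = ext_rel G B `` {A}"
    by (auto simp: Ext_split_def quotient_def)
  obtain S where S: "S \<in> hom_gr G (alg_Aut B)" "equivalent G B A (twisted_algebra G B S)"
    using crossed_product.split_imp_equivalent_twisted_algebra[OF A(1) assms(3) A(2)] by blast
  interpret S: algebra_action G B S
    using assms S by (simp add: algebra_action_def algebra_action_axioms_def)
  have "equivalent G B A A' \<longleftrightarrow> equivalent G B S.AS A'" for A' :: "('g, 'b, 'g \<Rightarrow> 'b) graded_algebra"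
    using S(2) equivalent_sym[OF A(1) S(2)] equivalent_trans by metis
  then have "E = ext_class G B S"
    using A S.AS_crossed_product by (simp add: ext_class_def ext_rel_def)
  then show "E \<in> Phi G B ` (hom_gr G (alg_Aut B) // hom_equiv G B)"
    using Phi_class[OF assms S(1)] quotientI[OF S(1), of "hom_equiv G B"] by (metis imageI)
qed

section \<open>The cyclic group of roots of unity\<close>

lemma roots_of_unity_group:
  assumes "n \<ge> 1"
  shows "group (roots_of_unity_group n)" "finite (carrier (roots_of_unity_group n))"
proof -
  let ?z = "exp (2 * of_real pi * \<i> / of_nat n) :: complex"
  have carrier: "carrier (roots_of_unity_group n) = (\<lambda>k. ?z ^ k) ` {..<n}"
    by (auto simp: roots_of_unity_group_def)
  then show "finite (carrier (roots_of_unity_group n))" by simp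
  have "?z ^ n = exp (of_nat n * (2 * of_real pi * \<i> / of_nat n))"
    by (rule exp_of_nat_mult[symmetric])
  also have "\<dots> = 1" using assms exp_two_pi_i by simp
  finally have z_n: "?z ^ n = 1" .
  \<comment> \<open>Arbitrary exponents are allowed because products lead to \<open>k + l\<close>
    and inverses to \<open>n - k\<close>, which equals \<open>n\<close> when
    \<open>k = 0\<close>.\<close>
  have mem: "?z ^ k \<in> carrier (roots_of_unity_group n)" for k
  proof -
    have "?z ^ k = ?z ^ (n * (k div n) + k mod n)" by simp
    also have "\<dots> = ?z ^ (k mod n)"
      by (simp only: power_add power_mult z_n power_one mult_1)
    finally show ?thesis using assms unfolding carrier by (auto simp: Suc_le_eq)
  qed
  show "group (roots_of_unity_group n)"
  proof (rule groupI)
    fix x assume "x \<in> carrier (roots_of_unity_group n)"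
    then obtain k where k: "k < n" "x = ?z ^ k" unfolding carrier by auto
    have "?z ^ (n - k) * x = 1"
      using k z_n by (simp flip: power_add)
    then show "\<exists>y\<in>carrier (roots_of_unity_group n). y \<otimes>\<^bsub>roots_of_unity_group n\<^esub> x
      = \<one>\<^bsub>roots_of_unity_group n\<^esub>"
      using mem[of "n - k"] by (auto simp: roots_of_unity_group_def intro: bexI)
    fix y assume "y \<in> carrier (roots_of_unity_group n)"
    then obtain l where "y = ?z ^ l" unfolding carrier by auto
    then have "x * y = ?z ^ (k + l)" using k by (simp add: power_add)
    then show "x \<otimes>\<^bsub>roots_of_unity_group n\<^esub> y \<in> carrier (roots_of_unity_group n)"
      using mem[of "k + l"] by (simp add: roots_of_unity_group_def)
  next
    show "\<one>\<^bsub>roots_of_unity_group n\<^esub> \<in> carrier (roots_of_unity_group n)"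
      using mem[of 0] by (simp add: roots_of_unity_group_def)
  qed (simp_all add: roots_of_unity_group_def mult.assoc)
qed

text \<open>\<open>Ext_split\<close> in the bijection collects algebras whose elements are
  coefficient functions. The last conjunct extends surjectivity to split crossed products over any
  element type.\<close>

theorem theorem3p6:
  fixes B :: "(complex, 'b) module" and n :: nat
  assumes "complex_algebra B" and "n \<ge> 1"
  shows "(\<forall>S\<in>hom_gr (roots_of_unity_group n) (alg_Aut B).
            crossed_product (roots_of_unity_group n) B (twisted_algebra (roots_of_unity_group n) B S) \<and>
            split_sequence (roots_of_unity_group n) (twisted_algebra (roots_of_unity_group n) B S)) \<and>
         ext_class (roots_of_unity_group n) B respects hom_equiv (roots_of_unity_group n) B \<and>
         bij_betw (Phi (roots_of_unity_group n) B)
           (hom_gr (roots_of_unity_group n) (alg_Aut B) // hom_equiv (roots_of_unity_group n) B)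
           (Ext_split (roots_of_unity_group n) B) \<and>
         (\<forall>A :: (complex, 'b, 'a) graded_algebra.
            crossed_product (roots_of_unity_group n) B A \<and> split_sequence (roots_of_unity_group n) A \<longrightarrow>
            (\<exists>S\<in>hom_gr (roots_of_unity_group n) (alg_Aut B).
               equivalent (roots_of_unity_group n) B A (twisted_algebra (roots_of_unity_group n) B S)))"
proof -
  note G = assms(1) roots_of_unity_group[OF assms(2)]
  have act: "algebra_action (roots_of_unity_group n) B S"
    if "S \<in> hom_gr (roots_of_unity_group n) (alg_Aut B)" for S
    using G that by (simp add: algebra_action_def algebra_action_axioms_def)
  have "ext_class (roots_of_unity_group n) B respects hom_equiv (roots_of_unity_group n) B"
    using ext_class_eq_iff[OF G] by (auto simp: congruent_def hom_equiv_def)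
  then show ?thesis
    using algebra_action.AS_crossed_product[OF act] algebra_action.AS_split[OF act] Phi_bij[OF G]
      crossed_product.split_imp_equivalent_twisted_algebra[OF _ G(3)]
    by blast
qed

end
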